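(* Let $\alpha,\beta\ge0$ and let $u$ be the solution of $-u_{xx}+\alpha u_x+\beta u=f$ on $(0,1)$, $u(0)=u(1)=0$. Let $k\ge1$ be an integer and assume $u\in C^{k+2}([0,1])$. Then there is a constant $c>0$, independent of the mesh $\tau$, such that for every admissible mesh $\tau$ of $(0,1)$ of size $h$, the $k$th correction $(u_i^k)_{i=0}^{N+1}$ (defined in the context) satisfies $$\left(\sum_{i=0}^{N}\frac{(e^k_{i+1}-e^k_i)^2}{h_{i+\frac12}}\right)^{\frac12}\le c\,h^{k+1}\,\|u\|_{k+2,\infty,[0,1]},$$ where $e_i^k=u_i^k-u(x_i)$ for $0\le i\le N+1$; that is, the error in the $k$th correction is of order $O(h^{k+1})$ in the discrete $H^1_0$ norm.
   Context: **Norm.** $\|w\|_{m,\infty,[0,1]}=\max_{0\le a\le m}\max_{[0,1]}|w^{(a)}|$. The notation $w_{jx}$ means the $j$th derivative of $w$ (with $w_{0x}=w$, $w_{1x}=w_x$). The function $f=-u_{xx}+\alpha u_x+\beta u$ and its derivatives are regarded as functions on $[0,1]$ (extended by continuity). **Admissible mesh $\tau$.** $N\in\mathbb N^*$ and points $x_0=x_{\frac12}=0<x_1<x_{\frac32}<\dots<x_{i-\frac12}<x_i<x_{i+\frac12}<\dots<x_N<x_{N+\frac12}=x_{N+1}=1$. Put $K_i=(x_{i-\frac12},x_{i+\frac12})$, $h_i=x_{i+\frac12}-x_{i-\frac12}$, $h_i^-=x_i-x_{i-\frac12}$, $h_i^+=x_{i+\frac12}-x_i$ for $1\le i\le N$;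 $h_0^+=h_{N+1}^-=0$; $h_{i+\frac12}=x_{i+1}-x_i$ for $0\le i\le N$; $h=\max_{1\le i\le N}h_i$. **Basic finite volume solution** $(u_i)_{i=0}^{N+1}$: $u_0=u_{N+1}=0$ and for $1\le i\le N$ $$-\frac{u_{i+1}-u_i}{h_{i+\frac12}}+\frac{u_i-u_{i-1}}{h_{i-\frac12}}+\alpha(u_i-u_{i-1})+\beta h_iu_i=\int_{K_i}f\,dx.$$ Put $u_i^0=u_i$. **Coefficients.** For $m\ge2$, the reals $\alpha^m_j$ ($0\le j\le m-2$), $\overline\alpha^m_1,\overline\alpha^m_2$, depending only on $\alpha,\beta,m$, are those in the identity $u_{mx}=\sum_{j=0}^{m-2}\alpha^m_jf_{jx}+\overline\alpha^m_1u+\overline\alpha^m_2u_x$ obtained by repeatedly differentiating $u_{2x}=\alpha u_x+\beta u-f$ and substituting for $u_{2x}$: $\alpha^2_0=-1$, $\overline\alpha^2_1=\beta$, $\overline\alpha^2_2=\alpha$, and $\alpha^{m+1}_0=-\overline\alpha^m_2$, $\alpha^{m+1}_j=\alpha^m_{j-1}$ ($1\le j\le m-1$), $\overline\alpha^{m+1}_1=\beta\,\overline\alpha^m_2$, $\overline\alpha^{m+1}_2=\overline\alpha^m_1+\alpha\,\overline\alpha^m_2$. Also, for $0\le i\le N$ and $m\ge 2$, $$a^i_m=\frac1{m!}\sum_{j=0}^{m-1}(h^-_{i+1})^j(-h_i^+)^{m-1-j}.$$ **Recursive definition of the $k$th correction** ($k\ge1$). Given $(u_i^{k-1})_{i=0}^{N+1}$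 and, if $k\ge2$, the arrays $(u_{jx}^{h,k-1})_i$ for $2\le j\le k$, define for $0\le i\le N$: (a) $\displaystyle (u_{(k+1)x}^{h,k})_i=\sum_{j=0}^{k-1}\alpha^{k+1}_jf_{jx}(x_i)+\overline\alpha^{k+1}_1u_i^{k-1}+\overline\alpha^{k+1}_2\frac{u_{i+1}^{k-1}-u_i^{k-1}}{h_{i+\frac12}}$; (b) for $2\le\ell\le k$: $\displaystyle (u_{\ell x}^{h,k})_i=\sum_{j=0}^{\ell-2}\alpha^\ell_jf_{jx}(x_i)+\overline\alpha^\ell_1u_i^{k-1}+\overline\alpha^\ell_2\Big(\frac{u_{i+1}^{k-1}-u_i^{k-1}}{h_{i+\frac12}}-\sum_{j=2}^{k-\ell+2}\frac{(u_{jx}^{h,k-1})_i}{j!}h_{i+\frac12}^{\,j-1}\Big)$; (c) $\displaystyle (u_{x}^{h,k})_i=(u_{1x}^{h,k})_i=\frac{u_{i+1}^{k-1}-u_i^{k-1}}{h_{i+\frac12}}-\sum_{j=2}^{k}\frac{h_{i+\frac12}^{\,j-1}}{j!}(u_{jx}^{h,k})_i$; (d) for $2\le\ell\le k+1$: $\displaystyle u_{\ell x}^{i+\frac12,k}=\sum_{j=0}^{k-\ell+1}\frac{(h_i^+)^j}{j!}(u_{(\ell+j)x}^{h,k})_i$. The $k$th correction $(u_i^k)_{i=0}^{N+1}$ is defined by $u_0^k=u_{N+1}^k=0$ and, for $1\le i\le N$, $$\begin{aligned} -\frac{u^k_{i+1}-u^k_i}{h_{i+\frac12}}&+\frac{u^k_i-u^k_{i-1}}{h_{i-\frac12}}+\alpha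 u^k_i-\alpha u^k_{i-1}+\beta h_iu_i^k=\int_{K_i}f\,dx\\ &-\sum_{m=2}^{k+1}a^i_m\,u_{mx}^{i+\frac12,k}+\sum_{m=2}^{k+1}a^{i-1}_m\,u_{mx}^{i-\frac12,k} -\alpha\sum_{m=1}^k\frac{(h_i^+)^m}{m!}(u_{mx}^{h,k})_i+\alpha\sum_{m=1}^k\frac{(h_{i-1}^+)^m}{m!}(u_{mx}^{h,k})_{i-1}\\ &-\beta\Big(\sum_{m=1}^k\frac{(h_i^+)^{m+1}}{(m+1)!}(u_{mx}^{h,k})_i-\sum_{m=1}^k\frac{(-h_i^-)^{m+1}}{(m+1)!}\sum_{j=0}^{k-m}\frac{h_{i-\frac12}^{\,j}}{j!}(u_{(m+j)x}^{h,k})_{i-1}\Big). \end{aligned}$$ *)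

theory Defs
  imports "HOL-Analysis.Analysis"
begin

section \<open>Derivatives and norms on the unit interval\<close>

text \<open>Derivatives are taken within \<open>[0,1]\<close>, hence one-sided at the end points. For functions
  in \<open>C\<^sup>m([0,1])\<close> this agrees with extending the derivatives on \<open>(0,1)\<close> by continuity, and no value
  of \<open>w\<close> outside \<open>[0,1]\<close> matters on \<open>[0,1]\<close>.\<close>

primrec nderiv :: "nat \<Rightarrow> (real \<Rightarrow> real) \<Rightarrow> real \<Rightarrow> real" where
  "nderiv 0 w = w"
| "nderiv (Suc j) w = (\<lambda>x. vector_derivative (nderiv j w) (at x within {0..1}))"

definition C_unit :: "nat \<Rightarrow> (real \<Rightarrow> real) \<Rightarrow> bool" where
  "C_unit m w \<longleftrightarrow>
     (\<forall>j<m. nderiv j w differentiable_on {0..1}) \<and> continuous_on {0..1} (nderiv m w)"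

text \<open>For \<open>w\<close> in \<open>C\<^sup>m([0,1])\<close> the supremum is attained.\<close>

definition C_norm :: "nat \<Rightarrow> (real \<Rightarrow> real) \<Rightarrow> real" where
  "C_norm m w = Max ((\<lambda>a. SUP x\<in>{0..1}. \<bar>nderiv a w x\<bar>) ` {0..m})"

section \<open>Admissible meshes\<close>

text \<open>\<open>pt \<tau> i\<close> is $x_i$ (\<open>0 \<le> i \<le> N + 1\<close>) and \<open>hpt \<tau> i\<close> is $x_{i+1/2}$ (\<open>0 \<le> i \<le> N\<close>).
  Values at other indices are irrelevant.\<close>

record mesh =
  msize :: nat
  pt :: "nat \<Rightarrow> real"
  hpt :: "nat \<Rightarrow> real"

definition admissible :: "mesh \<Rightarrow> bool" where
  "admissible \<tau> \<longleftrightarrow>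
     1 \<le> msize \<tau> \<and>
     pt \<tau> 0 = 0 \<and> hpt \<tau> 0 = 0 \<and>
     (\<forall>i\<in>{1..msize \<tau>}. hpt \<tau> (i - 1) < pt \<tau> i \<and> pt \<tau> i < hpt \<tau> i) \<and>
     hpt \<tau> (msize \<tau>) = 1 \<and> pt \<tau> (msize \<tau> + 1) = 1"

definition hcell :: "mesh \<Rightarrow> nat \<Rightarrow> real" where
  "hcell \<tau> i = hpt \<tau> i - hpt \<tau> (i - 1)"

text \<open>\<open>hminus\<close> is used for indices \<open>\<ge> 1\<close> only. The conventions
  $h_0^+ = h_{N+1}^- = 0$ follow from $x_{1/2} = x_0$ and $x_{N+1/2} = x_{N+1}$.\<close>

definition hminus :: "mesh \<Rightarrow> nat \<Rightarrow> real" where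
  "hminus \<tau> i = pt \<tau> i - hpt \<tau> (i - 1)"

definition hplus :: "mesh \<Rightarrow> nat \<Rightarrow> real" where
  "hplus \<tau> i = hpt \<tau> i - pt \<tau> i"

text \<open>\<open>hhalf \<tau> i\<close> is $h_{i+1/2}$.\<close>

definition hhalf :: "mesh \<Rightarrow> nat \<Rightarrow> real" where
  "hhalf \<tau> i = pt \<tau> (i + 1) - pt \<tau> i"

definition meshsize :: "mesh \<Rightarrow> real" where
  "meshsize \<tau> = Max (hcell \<tau> ` {1..msize \<tau>})"

text \<open>\<open>dquot \<tau> v i\<close> is the difference quotient of \<open>v\<close> at $x_{i+1/2}$.\<close>

definition dquot :: "mesh \<Rightarrow> (nat \<Rightarrow> real) \<Rightarrow> nat \<Rightarrow> real" where
  "dquot \<tau> v i = (v (i + 1) - v i) / hhalf \<tau> i"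

definition discrete_H10_norm :: "mesh \<Rightarrow> (nat \<Rightarrow> real) \<Rightarrow> real" where
  "discrete_H10_norm \<tau> v = sqrt (\<Sum>i = 0..msize \<tau>. (v (i + 1) - v i)\<^sup>2 / hhalf \<tau> i)"

section \<open>The finite volume operator\<close>

definition fv_op :: "real \<Rightarrow> real \<Rightarrow> mesh \<Rightarrow> (nat \<Rightarrow> real) \<Rightarrow> nat \<Rightarrow> real" where
  "fv_op \<alpha> \<beta> \<tau> v i =
     - dquot \<tau> v i + dquot \<tau> v (i - 1) + \<alpha> * (v i - v (i - 1)) + \<beta> * hcell \<tau> i * v i"

text \<open>Vectors indexed by \<open>0, \<dots>, N + 1\<close> are functions on \<open>nat\<close>; requiring them to vanish beyond
  \<open>N + 1\<close> makes the solution of the discrete problem unique as a function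
  (lemma \<open>fv_solution_ex1\<close>).\<close>

definition fv_solution ::
    "real \<Rightarrow> real \<Rightarrow> mesh \<Rightarrow> (nat \<Rightarrow> real) \<Rightarrow> (nat \<Rightarrow> real) \<Rightarrow> bool" where
  "fv_solution \<alpha> \<beta> \<tau> g v \<longleftrightarrow>
     v 0 = 0 \<and> v (msize \<tau> + 1) = 0 \<and>
     (\<forall>i\<in>{1..msize \<tau>}. fv_op \<alpha> \<beta> \<tau> v i = g i) \<and>
     (\<forall>i>msize \<tau> + 1. v i = 0)"

definition fv_solve :: "real \<Rightarrow> real \<Rightarrow> mesh \<Rightarrow> (nat \<Rightarrow> real) \<Rightarrow> nat \<Rightarrow> real" where
  "fv_solve \<alpha> \<beta> \<tau> g = (THE v. fv_solution \<alpha> \<beta> \<tau> g v)"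

text \<open>Unique solvability, by shooting: \<open>shoot\<close> solves the equations with first two values
  \<open>0\<close> and \<open>s\<close>.\<close>

fun shoot :: "real \<Rightarrow> real \<Rightarrow> mesh \<Rightarrow> (nat \<Rightarrow> real) \<Rightarrow> real \<Rightarrow> nat \<Rightarrow> real" where
  "shoot \<alpha> \<beta> \<tau> g s 0 = 0"
| "shoot \<alpha> \<beta> \<tau> g s (Suc 0) = s"
| "shoot \<alpha> \<beta> \<tau> g s (Suc (Suc i)) =
     shoot \<alpha> \<beta> \<tau> g s (Suc i) + hhalf \<tau> (Suc i) *
       ((shoot \<alpha> \<beta> \<tau> g s (Suc i) - shoot \<alpha> \<beta> \<tau> g s i) / hhalf \<tau> i
        + \<alpha> * (shoot \<alpha> \<beta> \<tau> g s (Suc i) - shoot \<alpha> \<beta> \<tau> g s i)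
        + \<beta> * hcell \<tau> (Suc i) * shoot \<alpha> \<beta> \<tau> g s (Suc i) - g (Suc i))"

lemma hcell_pos:
  assumes "admissible \<tau>" "i \<in> {1..msize \<tau>}"
  shows "0 < hcell \<tau> i"
  using assms unfolding admissible_def hcell_def by fastforce

lemma hhalf_pos:
  assumes "admissible \<tau>" "i \<le> msize \<tau>"
  shows "0 < hhalf \<tau> i"
proof -
  have a: "hpt \<tau> (j - 1) < pt \<tau> j" "pt \<tau> j < hpt \<tau> j" if "1 \<le> j" "j \<le> msize \<tau>" for j
    using assms(1) that unfolding admissible_def by simp_all
  have 0: "pt \<tau> 0 = 0" "hpt \<tau> 0 = 0" "hpt \<tau> (msize \<tau>) = 1" "pt \<tau> (msize \<tau> + 1) = 1"
    "1 \<le> msize \<tau>"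
    using assms(1) unfolding admissible_def by simp_all
  show ?thesis
  proof (cases "i = msize \<tau>")
    case True
    then show ?thesis using 0 a(2)[of i] unfolding hhalf_def by simp
  next
    case False
    have "pt \<tau> i \<le> hpt \<tau> i"
      using 0(1,2) a(2)[of i] assms(2) by (cases "i = 0") simp_all
    moreover have "hpt \<tau> i < pt \<tau> (i + 1)"
      using a(1)[of "i + 1"] False assms(2) by simp
    ultimately show ?thesis unfolding hhalf_def by simp
  qed
qed

lemma shoot_fv_op:
  assumes "admissible \<tau>" "i \<in> {1..msize \<tau>}"
  shows "fv_op \<alpha> \<beta> \<tau> (shoot \<alpha> \<beta> \<tau> g s) i = g i"
proof -
  obtain j where j: "i = Suc j" using assms by (cases i) auto
  show ?thesis
    using hhalf_pos[OF assms(1), of i] assms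
    unfolding fv_op_def dquot_def j by simp
qed

lemma shoot_unique:
  assumes "admissible \<tau>" "v 0 = 0" "\<forall>i\<in>{1..msize \<tau>}. fv_op \<alpha> \<beta> \<tau> v i = g i"
    and "n \<le> msize \<tau> + 1"
  shows "v n = shoot \<alpha> \<beta> \<tau> g (v 1) n"
  using assms(4)
proof (induction n rule: less_induct)
  case (less n)
  consider "n = 0" | "n = 1" | j where "n = Suc (Suc j)"
    proof (cases n)
      case (Suc m)
      then show ?thesis using that by (cases m) auto
    qed (use that in auto)
  then show ?case
  proof cases
    case 3
    have IH: "shoot \<alpha> \<beta> \<tau> g (v 1) j = v j" "shoot \<alpha> \<beta> \<tau> g (v 1) (Suc j) = v (Suc j)"
      by (rule less.IH[symmetric]; use less.prems 3 in simp)+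
    have op: "fv_op \<alpha> \<beta> \<tau> v (Suc j) = g (Suc j)" and h: "hhalf \<tau> (Suc j) > 0"
      using assms(3) less.prems 3 hhalf_pos[OF assms(1)] by auto
    define d where "d = dquot \<tau> v (Suc j)"
    have "v (Suc (Suc j)) = v (Suc j) + hhalf \<tau> (Suc j) * d"
      using h unfolding d_def dquot_def by simp
    moreover have "d = (v (Suc j) - v j) / hhalf \<tau> j + \<alpha> * (v (Suc j) - v j)
        + \<beta> * hcell \<tau> (Suc j) * v (Suc j) - g (Suc j)"
      using op unfolding fv_op_def d_def[symmetric] by (simp add: dquot_def)
    ultimately show ?thesis
      unfolding 3 shoot.simps IH by simp
  qed (simp_all add: assms(2))
qed

lemma shoot_affine:
  "shoot \<alpha> \<beta> \<tau> g s n = shoot \<alpha> \<beta> \<tau> g 0 n + s * shoot \<alpha> \<beta> \<tau> (\<lambda>_. 0) 1 n"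
proof (induction \<alpha> \<beta> \<tau> g s n rule: shoot.induct)
  case (3 \<alpha> \<beta> \<tau> g s i)
  define a b c d where "a = shoot \<alpha> \<beta> \<tau> g 0 i" and "b = shoot \<alpha> \<beta> \<tau> (\<lambda>_. 0) 1 i"
    and "c = shoot \<alpha> \<beta> \<tau> g 0 (Suc i)" and "d = shoot \<alpha> \<beta> \<tau> (\<lambda>_. 0) 1 (Suc i)"
  have i: "shoot \<alpha> \<beta> \<tau> g s i = a + s * b" "shoot \<alpha> \<beta> \<tau> g s (Suc i) = c + s * d"
    using 3 unfolding a_def b_def c_def d_def by blast+
  show ?case
    unfolding shoot.simps i a_def[symmetric] b_def[symmetric] c_def[symmetric] d_def[symmetric]
    by (simp add: divide_inverse) algebra
qed simp_all

lemma shoot_pos: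
  assumes "0 \<le> \<alpha>" "0 \<le> \<beta>" "admissible \<tau>" "n \<le> msize \<tau>"
  defines "p \<equiv> shoot \<alpha> \<beta> \<tau> (\<lambda>_. 0) 1"
  shows "0 \<le> p n \<and> p n < p (Suc n)"
  using assms(4)
proof (induction n)
  case 0
  then show ?case unfolding p_def by simp
next
  case (Suc n)
  then have IH: "0 \<le> p n" "p n < p (Suc n)" by auto
  have "0 < (p (Suc n) - p n) / hhalf \<tau> n"
    using IH hhalf_pos[OF assms(3), of n] Suc.prems by simp
  moreover have "0 \<le> \<alpha> * (p (Suc n) - p n)" using IH assms by simp
  moreover have "0 \<le> \<beta> * hcell \<tau> (Suc n) * p (Suc n)"
    using IH assms(2) hcell_pos[OF assms(3), of "Suc n"] Suc.prems by simp
  ultimately have "0 < hhalf \<tau> (Suc n) * ((p (Suc n) - p n) / hhalf \<tau> n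
        + \<alpha> * (p (Suc n) - p n) + \<beta> * hcell \<tau> (Suc n) * p (Suc n) - 0)"
    using hhalf_pos[OF assms(3), of "Suc n"] Suc.prems by simp
  then show ?case using IH unfolding p_def by simp
qed

lemma fv_solution_ex1:
  assumes "0 \<le> \<alpha>" "0 \<le> \<beta>" "admissible \<tau>"
  shows "\<exists>!v. fv_solution \<alpha> \<beta> \<tau> g v"
proof -
  define N where "N = msize \<tau>"
  define p where "p = shoot \<alpha> \<beta> \<tau> (\<lambda>_. 0) 1"
  define q where "q = shoot \<alpha> \<beta> \<tau> g 0"
  have p: "p (N + 1) > 0"
    using shoot_pos[OF assms, of N] unfolding p_def N_def by simp
  define s where "s = - q (N + 1) / p (N + 1)"
  define v where "v = (\<lambda>i. if i \<le> N + 1 then shoot \<alpha> \<beta> \<tau> g s i else 0)"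
  have "fv_op \<alpha> \<beta> \<tau> v i = fv_op \<alpha> \<beta> \<tau> (shoot \<alpha> \<beta> \<tau> g s) i" if "i \<le> N" for i
    using that unfolding fv_op_def dquot_def v_def by auto
  moreover have "v (N + 1) = 0"
    using p shoot_affine[of \<alpha> \<beta> \<tau> g s "N + 1"]
    unfolding v_def s_def p_def[symmetric] q_def[symmetric] by simp
  ultimately have ex: "fv_solution \<alpha> \<beta> \<tau> g v"
    using shoot_fv_op[OF assms(3)] unfolding fv_solution_def N_def[symmetric]
    by (auto simp: v_def N_def)
  moreover have "w = v" if w: "fv_solution \<alpha> \<beta> \<tau> g w" for w
  proof -
    have eq: "w n = shoot \<alpha> \<beta> \<tau> g (w 1) n" if "n \<le> N + 1" for n
      using shoot_unique[OF assms(3), of w] w that unfolding fv_solution_def N_def by blast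
    have "q (N + 1) + w 1 * p (N + 1) = 0"
      using eq[of "N + 1"] w shoot_affine[of \<alpha> \<beta> \<tau> g "w 1" "N + 1"]
      unfolding fv_solution_def N_def p_def q_def by simp
    then have "w 1 * p (N + 1) = - q (N + 1)" by linarith
    then have "w 1 = s" using p unfolding s_def by (metis nonzero_eq_divide_eq less_irrefl)
    then have "w n = v n" for n
      using eq[of n] w unfolding v_def fv_solution_def N_def[symmetric]
      by (cases "n \<le> N + 1") simp_all
    then show ?thesis by blast
  qed
  ultimately show ?thesis by blast
qed

section \<open>Coefficients\<close>

text \<open>\<open>co \<alpha> \<beta> m j\<close>, \<open>co1 \<alpha> \<beta> m\<close>, \<open>co2 \<alpha> \<beta> m\<close> are $\alpha^m_j$, $\overline\alpha^m_1$,
  $\overline\alpha^m_2$. They are meaningful for \<open>m \<ge> 2\<close> and \<open>j \<le> m - 2\<close> only.\<close>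

fun co1 :: "real \<Rightarrow> real \<Rightarrow> nat \<Rightarrow> real" and co2 :: "real \<Rightarrow> real \<Rightarrow> nat \<Rightarrow> real" where
  "co1 \<alpha> \<beta> 0 = 0"
| "co1 \<alpha> \<beta> (Suc 0) = 0"
| "co1 \<alpha> \<beta> (Suc (Suc 0)) = \<beta>"
| "co1 \<alpha> \<beta> (Suc (Suc (Suc m))) = \<beta> * co2 \<alpha> \<beta> (Suc (Suc m))"
| "co2 \<alpha> \<beta> 0 = 0"
| "co2 \<alpha> \<beta> (Suc 0) = 0"
| "co2 \<alpha> \<beta> (Suc (Suc 0)) = \<alpha>"
| "co2 \<alpha> \<beta> (Suc (Suc (Suc m))) = co1 \<alpha> \<beta> (Suc (Suc m)) + \<alpha> * co2 \<alpha> \<beta> (Suc (Suc m))"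

fun co :: "real \<Rightarrow> real \<Rightarrow> nat \<Rightarrow> nat \<Rightarrow> real" where
  "co \<alpha> \<beta> 0 j = 0"
| "co \<alpha> \<beta> (Suc 0) j = 0"
| "co \<alpha> \<beta> (Suc (Suc 0)) j = (if j = 0 then -1 else 0)"
| "co \<alpha> \<beta> (Suc (Suc (Suc m))) 0 = - co2 \<alpha> \<beta> (Suc (Suc m))"
| "co \<alpha> \<beta> (Suc (Suc (Suc m))) (Suc j) = co \<alpha> \<beta> (Suc (Suc m)) j"

text \<open>\<open>amesh \<tau> i m\<close> is $a^i_m$.\<close>

definition amesh :: "mesh \<Rightarrow> nat \<Rightarrow> nat \<Rightarrow> real" where
  "amesh \<tau> i m =
     1 / fact m * (\<Sum>j = 0..m - 1. hminus \<tau> (i + 1) ^ j * (- hplus \<tau> i) ^ (m - 1 - j))"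

section \<open>Corrections\<close>

text \<open>Approximate derivatives at $x_i$ of order \<open>l\<close> at level \<open>k \<ge> 1\<close>. Here \<open>v\<close> is the correction
  of level \<open>k - 1\<close> and \<open>E l i\<close> its array $(u_{lx}^{h,k-1})_i$ of approximate derivatives.
  \<open>approx_derivs_high\<close> is for \<open>2 \<le> l \<le> k + 1\<close>, \<open>approx_derivs\<close> for \<open>1 \<le> l \<le> k + 1\<close>.\<close>

definition approx_derivs_high :: "real \<Rightarrow> real \<Rightarrow> (real \<Rightarrow> real) \<Rightarrow> mesh \<Rightarrow> nat \<Rightarrow>
    (nat \<Rightarrow> real) \<Rightarrow> (nat \<Rightarrow> nat \<Rightarrow> real) \<Rightarrow> nat \<Rightarrow> nat \<Rightarrow> real" where
  "approx_derivs_high \<alpha> \<beta> f \<tau> k v E l i =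
     (if l = k + 1 then
        (\<Sum>j = 0..k - 1. co \<alpha> \<beta> (k + 1) j * nderiv j f (pt \<tau> i))
        + co1 \<alpha> \<beta> (k + 1) * v i + co2 \<alpha> \<beta> (k + 1) * dquot \<tau> v i
      else
        (\<Sum>j = 0..l - 2. co \<alpha> \<beta> l j * nderiv j f (pt \<tau> i))
        + co1 \<alpha> \<beta> l * v i
        + co2 \<alpha> \<beta> l *
            (dquot \<tau> v i - (\<Sum>j = 2..k + 2 - l. E j i / fact j * hhalf \<tau> i ^ (j - 1))))"

definition approx_derivs :: "real \<Rightarrow> real \<Rightarrow> (real \<Rightarrow> real) \<Rightarrow> mesh \<Rightarrow> nat \<Rightarrow>
    (nat \<Rightarrow> real) \<Rightarrow> (nat \<Rightarrow> nat \<Rightarrow> real) \<Rightarrow> nat \<Rightarrow> nat \<Rightarrow> real" where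
  "approx_derivs \<alpha> \<beta> f \<tau> k v E l i =
     (if l = 1 then
        dquot \<tau> v i
        - (\<Sum>j = 2..k. hhalf \<tau> i ^ (j - 1) / fact j * approx_derivs_high \<alpha> \<beta> f \<tau> k v E j i)
      else approx_derivs_high \<alpha> \<beta> f \<tau> k v E l i)"

text \<open>In the following, \<open>D l i\<close> is $(u_{lx}^{h,k})_i$; \<open>half_deriv\<close> is $u_{lx}^{i+1/2,k}$ for
  \<open>2 \<le> l \<le> k + 1\<close>.\<close>

definition half_deriv :: "mesh \<Rightarrow> nat \<Rightarrow> (nat \<Rightarrow> nat \<Rightarrow> real) \<Rightarrow> nat \<Rightarrow> nat \<Rightarrow> real" where
  "half_deriv \<tau> k D l i = (\<Sum>j = 0..k + 1 - l. hplus \<tau> i ^ j / fact j * D (l + j) i)"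

definition fv_rhs :: "(real \<Rightarrow> real) \<Rightarrow> mesh \<Rightarrow> nat \<Rightarrow> real" where
  "fv_rhs f \<tau> i = integral {hpt \<tau> (i - 1)<..<hpt \<tau> i} f"

definition corr_rhs :: "real \<Rightarrow> real \<Rightarrow> (real \<Rightarrow> real) \<Rightarrow> mesh \<Rightarrow> nat \<Rightarrow>
    (nat \<Rightarrow> nat \<Rightarrow> real) \<Rightarrow> nat \<Rightarrow> real" where
  "corr_rhs \<alpha> \<beta> f \<tau> k D i =
     fv_rhs f \<tau> i
     - (\<Sum>m = 2..k + 1. amesh \<tau> i m * half_deriv \<tau> k D m i)
     + (\<Sum>m = 2..k + 1. amesh \<tau> (i - 1) m * half_deriv \<tau> k D m (i - 1))
     - \<alpha> * (\<Sum>m = 1..k. hplus \<tau> i ^ m / fact m * D m i)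
     + \<alpha> * (\<Sum>m = 1..k. hplus \<tau> (i - 1) ^ m / fact m * D m (i - 1))
     - \<beta> * ((\<Sum>m = 1..k. hplus \<tau> i ^ (m + 1) / fact (m + 1) * D m i)
            - (\<Sum>m = 1..k. (- hminus \<tau> i) ^ (m + 1) / fact (m + 1)
                * (\<Sum>j = 0..k - m. hhalf \<tau> (i - 1) ^ j / fact j * D (m + j) (i - 1))))"

text \<open>The pair of $(u_i^k)_i$ and $((u_{lx}^{h,k})_i)_{l,i}$. At level \<open>0\<close> the derivative arrays do
  not exist; the zero placeholder is never read, since the sum over \<open>E\<close> in \<open>approx_derivs_high\<close> only
  occurs for \<open>k \<ge> 2\<close>.\<close>

primrec fv_level :: "real \<Rightarrow> real \<Rightarrow> (real \<Rightarrow> real) \<Rightarrow> mesh \<Rightarrow> nat \<Rightarrow>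
    (nat \<Rightarrow> real) \<times> (nat \<Rightarrow> nat \<Rightarrow> real)" where
  "fv_level \<alpha> \<beta> f \<tau> 0 = (fv_solve \<alpha> \<beta> \<tau> (fv_rhs f \<tau>), \<lambda>l i. 0)"
| "fv_level \<alpha> \<beta> f \<tau> (Suc k) =
     (let D = approx_derivs \<alpha> \<beta> f \<tau> (Suc k) (fst (fv_level \<alpha> \<beta> f \<tau> k)) (snd (fv_level \<alpha> \<beta> f \<tau> k))
      in (fv_solve \<alpha> \<beta> \<tau> (corr_rhs \<alpha> \<beta> f \<tau> (Suc k) D), D))"

definition correction :: "real \<Rightarrow> real \<Rightarrow> (real \<Rightarrow> real) \<Rightarrow> mesh \<Rightarrow> nat \<Rightarrow> nat \<Rightarrow> real" where
  "correction \<alpha> \<beta> f \<tau> k = fst (fv_level \<alpha> \<beta> f \<tau> k)"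

section \<open>The boundary value problem\<close>

text \<open>The right-hand side \<open>f\<close> is given on \<open>(0,1)\<close> by the equation and at the end points by
  continuity.\<close>

definition solves_bvp :: "real \<Rightarrow> real \<Rightarrow> (real \<Rightarrow> real) \<Rightarrow> (real \<Rightarrow> real) \<Rightarrow> bool" where
  "solves_bvp \<alpha> \<beta> f u \<longleftrightarrow>
     continuous_on {0..1} f \<and>
     (\<forall>x\<in>{0<..<1}. - nderiv 2 u x + \<alpha> * nderiv 1 u x + \<beta> * u x = f x) \<and>
     u 0 = 0 \<and> u 1 = 0"

end

theory Submission
  imports Defs
begin

text \<open>
  Write $u_i = u(x_i)$, $e^k_i = u^k_i - u_i$ and
  $\varepsilon^k_\ell(i) = (u_{\ell x}^{h,k})_i - u_{\ell x}(x_i)$. Integrating the differential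
  equation over a cell $K_i$ gives an exact balance of the fluxes at $x_{i-1/2}$ and $x_{i+1/2}$
  and of the integral of $u$ over $K_i$. The right-hand side of the $k$th correction is made so
  that the scheme becomes this balance with each of these three terms expanded by Taylor's formula
  to order $k+1$, the derivatives of $u$ being replaced by the approximations
  $(u_{\ell x}^{h,k})_i$. Hence the error satisfies
  \<open>fv_op e\<^sup>k i = G i - G (i - 1) + \<beta> * T i\<close>
  (lemma \<open>error_equation\<close>), where \<open>G\<close> and \<open>T\<close> consist of Taylor remainders and of the
  \<open>\<epsilon>\<^sup>k\<close>, each multiplied by a power of the mesh lengths.

  The scheme is stable with respect to such right-hand sides (lemma \<open>fv_stability\<close>): testing with
  $e^k$ and summing by parts moves the difference of \<open>G\<close> onto $e^k$, so the discrete $H^1_0$ norm of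
  $e^k$ is at most the weighted root mean square of \<open>G\<close> plus \<open>\<beta>\<close> times the sum of all
  \<open>\<bar>T i\<bar>\<close>. It is essential that \<open>G\<close> enters without being differenced, since on a
  non-uniform mesh its differences gain no order.

  It remains to bound the \<open>\<epsilon>\<^sup>k\<close>, by induction on \<open>k\<close>. The differential equation
  expresses every derivative $u_{\ell x}$ by $u$, $u_x$ and derivatives of $f$
  (lemma \<open>nderiv_expansion\<close>), so that only $u$ and $u_x$ have to be approximated, from $u^{k-1}$. If
  the difference quotients of $e^{k-1}$ are $O(h^k)$ in mean square and
  $\varepsilon^{k-1}_\ell = O(h^{k+1-\ell})$ for $2\le\ell\le k$, then
  $\varepsilon^k_\ell = O(h^{k+2-\ell})$ for $2\le\ell\le k+1$ and $\varepsilon^k_1 = O(h^k)$, and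
  these are the orders for which \<open>G\<close> and \<open>T\<close> are $O(h^{k+1})$. The basic scheme is the case
  \<open>k = 0\<close>, in which all correction sums are empty.

  The difference quotients of $e^{k-1}$ are controlled in mean square only, and not at each point,
  because neighbouring mesh lengths need not be comparable. For this reason all orders are measured
  in the mean square weighted by the lengths $h_{i+1/2}$ (predicate \<open>mean_order\<close>), while
  coefficients depending on the mesh alone are bounded at each point (predicate
  \<open>coeff_order\<close>). Both predicates hide a constant that is uniform in the mesh and in \<open>u\<close>.
\<close>

section \<open>Calculus on the unit interval\<close>

\<comment> \<open>Derivatives are handled through their values below, not as vector derivatives.\<close>
declare nderiv.simps(2) [simp del]

lemma C_unit_has_field_derivative:
  assumes "C_unit m u" "a < m" "x \<in> {0..1}"
  shows "(nderiv a u has_field_derivative nderiv (Suc a) u x) (at x within {0..1})"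
  using assms unfolding C_unit_def differentiable_on_def nderiv.simps
    has_real_derivative_iff_has_vector_derivative
  by (metis vector_derivative_works)

lemma C_unit_continuous_on:
  assumes "C_unit m u" "a \<le> m"
  shows "continuous_on {0..1} (nderiv a u)"
  using assms unfolding C_unit_def
  by (metis differentiable_imp_continuous_on le_neq_implies_less)

lemma abs_nderiv_le_C_norm:
  assumes "C_unit m u" "a \<le> m" "x \<in> {0..1}"
  shows "\<bar>nderiv a u x\<bar> \<le> C_norm m u"
proof -
  have "continuous_on {0..1} (\<lambda>x. \<bar>nderiv a u x\<bar>)"
    using C_unit_continuous_on[OF assms(1,2)] by (intro continuous_intros)
  then have "compact ((\<lambda>x. \<bar>nderiv a u x\<bar>) ` {0..1})"
    by (rule compact_continuous_image) simp
  then have "bdd_above ((\<lambda>x. \<bar>nderiv a u x\<bar>) ` {0..1})"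
    by (intro bounded_imp_bdd_above compact_imp_bounded)
  then have "\<bar>nderiv a u x\<bar> \<le> (SUP x\<in>{0..1}. \<bar>nderiv a u x\<bar>)"
    using assms(3) by (intro cSUP_upper) auto
  also have "\<dots> \<le> C_norm m u"
    unfolding C_norm_def using assms(2) by (intro Max_ge) auto
  finally show ?thesis .
qed

lemma C_norm_nonneg: "C_unit m u \<Longrightarrow> 0 \<le> C_norm m u"
  using abs_nderiv_le_C_norm[of m u 0 0] by auto

text \<open>A function given only by its values on the unit interval, such as \<open>f\<close>, can be differentiated
  through any representation valid there, since derivatives are taken within the interval.\<close>

lemma nderiv_unique:
  assumes "\<And>x. x \<in> {0..1} \<Longrightarrow> w x = g 0 x"
    and "\<And>j x. j < n \<Longrightarrow> x \<in> {0..1} \<Longrightarrow>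
      (g j has_field_derivative g (Suc j) x) (at x within {0..1})"
    and "j \<le> n" "x \<in> {0..1}"
  shows "nderiv j w x = g j x"
  using assms(3,4)
proof (induction j arbitrary: x)
  case 0
  then show ?case using assms(1) by simp
next
  case (Suc j)
  have "(g j has_vector_derivative g (Suc j) x) (at x within {0..1})"
    using assms(2)[of j x] Suc.prems by (simp add: has_real_derivative_iff_has_vector_derivative)
  then have "(nderiv j w has_vector_derivative g (Suc j) x) (at x within {0..1})"
    using Suc by (intro has_vector_derivative_transform[of x "{0..1}" "nderiv j w" "g j"]) auto
  then show ?case
    using Suc.prems by (simp add: nderiv.simps vector_derivative_within_closed_interval)
qed

lemma taylor_unit_interval:
  assumes "\<And>i x. x \<in> {0..1} \<Longrightarrow> i \<le> n \<Longrightarrow>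
      (g i has_field_derivative g (Suc i) x) (at x within {0..1})"
    and "\<And>x. x \<in> {0..1} \<Longrightarrow> \<bar>g (Suc n) x\<bar> \<le> B"
    and "x \<in> {0..1}" "y \<in> {0..1::real}"
  shows "\<bar>g 0 y - (\<Sum>i\<le>n. (y - x) ^ i / fact i * g i x)\<bar> \<le> B * \<bar>y - x\<bar> ^ Suc n"
proof -
  have B: "0 \<le> B" using assms(2)[OF assms(3)] by linarith
  have "\<bar>g 0 y - (\<Sum>i\<le>n. (y - x) ^ i / fact i * g i x)\<bar> \<le> B * \<bar>y - x\<bar> ^ Suc n / fact n"
    using field_Taylor[of "{0..1}" n g B x y] assms by (simp add: mult.commute)
  also have "\<dots> \<le> B * \<bar>y - x\<bar> ^ Suc n"
    using divide_left_mono[OF fact_ge_1[of n], of "B * \<bar>y - x\<bar> ^ Suc n"] B by simp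
  finally show ?thesis .
qed

lemma taylor_nderiv:
  assumes "C_unit m u" "a + n < m" "x \<in> {0..1}" "y \<in> {0..1}"
  shows "\<bar>nderiv a u y - (\<Sum>i\<le>n. (y - x) ^ i / fact i * nderiv (a + i) u x)\<bar>
    \<le> C_norm m u * \<bar>y - x\<bar> ^ Suc n"
  using taylor_unit_interval[of n "\<lambda>i. nderiv (a + i) u" "C_norm m u" x y] assms
    C_unit_has_field_derivative[OF assms(1)] abs_nderiv_le_C_norm[OF assms(1)]
  by simp

definition antideriv :: "(real \<Rightarrow> real) \<Rightarrow> real \<Rightarrow> real" where
  "antideriv u x = integral {0..x} u"

lemma antideriv_has_field_derivative:
  assumes "continuous_on {0..1} u" "x \<in> {0..1}"
  shows "(antideriv u has_field_derivative u x) (at x within {0..1})"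
  using integral_has_real_derivative[OF assms] by (simp add: antideriv_def[abs_def])

text \<open>The cell integrals of \<open>u\<close> are expanded as increments of an antiderivative: it is Taylor's
  formula for the sequence of functions \<open>antideriv u\<close>, \<open>u\<close>, \<open>nderiv 1 u\<close>, and so on.\<close>

lemma taylor_antideriv:
  assumes "C_unit m u" "n < m" "x \<in> {0..1}" "y \<in> {0..1}"
  shows "\<bar>antideriv u y - antideriv u x
      - (\<Sum>i\<le>n. (y - x) ^ Suc i / fact (Suc i) * nderiv i u x)\<bar>
    \<le> C_norm m u * \<bar>y - x\<bar> ^ (n + 2)"
proof -
  define g where "g = case_nat (antideriv u) (\<lambda>i. nderiv i u)"
  have g: "g 0 = antideriv u" "g (Suc i) = nderiv i u" for i
    by (simp_all add: g_def)
  have c: "continuous_on {0..1} u"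
    using C_unit_continuous_on[OF assms(1), of 0] by simp
  have "(g i has_field_derivative g (Suc i) x) (at x within {0..1})"
    if "x \<in> {0..1}" "i \<le> Suc n" for i x
    using that C_unit_has_field_derivative[OF assms(1)] antideriv_has_field_derivative[OF c] assms(2)
    by (cases i) (auto simp: g)
  moreover have "\<bar>g (Suc (Suc n)) x\<bar> \<le> C_norm m u" if "x \<in> {0..1}" for x
    unfolding g using abs_nderiv_le_C_norm[OF assms(1)] that assms(2) by simp
  ultimately have "\<bar>g 0 y - (\<Sum>i\<le>Suc n. (y - x) ^ i / fact i * g i x)\<bar>
      \<le> C_norm m u * \<bar>y - x\<bar> ^ Suc (Suc n)"
    using assms(3,4) by (intro taylor_unit_interval)
  then show ?thesis
    unfolding sum.atMost_Suc_shift g by (simp add: algebra_simps)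
qed

section \<open>Consequences of the differential equation\<close>

text \<open>Both sides are continuous and agree in the open interval.\<close>

lemma bvp_on_closed_interval:
  assumes "solves_bvp \<alpha> \<beta> f u" "C_unit m u" "2 \<le> m" "x \<in> {0..1}"
  shows "f x = - nderiv 2 u x + \<alpha> * nderiv 1 u x + \<beta> * u x"
proof -
  define g where "g x = f x - (- nderiv 2 u x + \<alpha> * nderiv 1 u x + \<beta> * u x)" for x
  have "continuous_on {0..1} g"
    unfolding g_def
    using C_unit_continuous_on[OF assms(2), of 2] C_unit_continuous_on[OF assms(2), of 1]
      C_unit_continuous_on[OF assms(2), of 0] assms(1,3)
    by (intro continuous_intros) (auto simp: solves_bvp_def)
  then have "continuous_on (closure {0<..<1}) g" by simp
  moreover have "g x = 0" if "x \<in> {0<..<1}" for x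
    using assms(1) that by (simp add: solves_bvp_def g_def)
  moreover have "x \<in> closure {0<..<1}" using assms(4) by simp
  ultimately have "g x = 0"
    by (rule continuous_constant_on_closure)
  then show ?thesis by (simp add: g_def)
qed

lemma nderiv_rhs:
  assumes "solves_bvp \<alpha> \<beta> f u" "C_unit m u" "j + 2 \<le> m" "x \<in> {0..1}"
  shows "nderiv j f x = - nderiv (j + 2) u x + \<alpha> * nderiv (j + 1) u x + \<beta> * nderiv j u x"
proof (rule nderiv_unique[where n = j and
      g = "\<lambda>j x. - nderiv (j + 2) u x + \<alpha> * nderiv (j + 1) u x + \<beta> * nderiv j u x"])
  show "f x = - nderiv (0 + 2) u x + \<alpha> * nderiv (0 + 1) u x + \<beta> * nderiv 0 u x"
    if "x \<in> {0..1}" for x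
    using bvp_on_closed_interval[OF assms(1,2) _ that] assms(3) by (simp add: numeral_2_eq_2)
  show "((\<lambda>x. - nderiv (i + 2) u x + \<alpha> * nderiv (i + 1) u x + \<beta> * nderiv i u x)
      has_field_derivative - nderiv (Suc i + 2) u x + \<alpha> * nderiv (Suc i + 1) u x
        + \<beta> * nderiv (Suc i) u x) (at x within {0..1})" if "i < j" "x \<in> {0..1}" for i x
    using C_unit_has_field_derivative[OF assms(2), of "i + 2" x]
      C_unit_has_field_derivative[OF assms(2), of "i + 1" x]
      C_unit_has_field_derivative[OF assms(2), of i x] that assms(3)
    by (auto intro!: derivative_intros DERIV_cmult)
qed (use assms in auto)

text \<open>The recursion for the coefficients, detached from analysis: expand the sequence shifted by one,
  whose first two members are \<open>U 1\<close> and \<open>U 2\<close>, and substitute for \<open>U 2\<close>. The shift turns the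
  coefficient of \<open>F j\<close> into that of \<open>F (Suc j)\<close>.\<close>

lemma co_expansion:
  fixes U F :: "nat \<Rightarrow> real"
  assumes "2 \<le> m" "\<And>j. j \<le> m - 2 \<Longrightarrow> U (j + 2) = \<alpha> * U (j + 1) + \<beta> * U j - F j"
  shows "U m = (\<Sum>j = 0..m - 2. co \<alpha> \<beta> m j * F j) + co1 \<alpha> \<beta> m * U 0 + co2 \<alpha> \<beta> m * U 1"
  using assms
proof (induction m arbitrary: U F rule: nat_induct_at_least)
  case base
  show ?case using base[of 0] by (simp add: numeral_2_eq_2)
next
  case (Suc m)
  obtain n where n: "m = Suc (Suc n)"
    using \<open>2 \<le> m\<close> by (metis Suc_le_D numeral_2_eq_2 Suc_le_mono)
  have "U (Suc m) = (\<Sum>j = 0..m - 2. co \<alpha> \<beta> m j * F (Suc j)) + co1 \<alpha> \<beta> m * U (Suc 0)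
      + co2 \<alpha> \<beta> m * U (Suc 1)"
    using Suc.prems[of "Suc j" for j] \<open>2 \<le> m\<close>
    by (intro Suc.IH[where U = "\<lambda>j. U (Suc j)" and F = "\<lambda>j. F (Suc j)"]) simp
  moreover have "U (Suc (Suc 0)) = \<alpha> * U (Suc 0) + \<beta> * U 0 - F 0"
    using Suc.prems[of 0] by (simp add: numeral_2_eq_2)
  ultimately show ?case
    unfolding n by (simp add: sum.atLeast0_atMost_Suc_shift algebra_simps del: sum.cl_ivl_Suc)
qed

lemma nderiv_expansion:
  assumes "solves_bvp \<alpha> \<beta> f u" "C_unit n u" "2 \<le> m" "m \<le> n" "x \<in> {0..1}"
  shows "nderiv m u x = (\<Sum>j = 0..m - 2. co \<alpha> \<beta> m j * nderiv j f x) + co1 \<alpha> \<beta> m * u x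
    + co2 \<alpha> \<beta> m * nderiv 1 u x"
  using co_expansion[of m "\<lambda>j. nderiv j u x" \<alpha> \<beta> "\<lambda>j. nderiv j f x"] assms
    nderiv_rhs[OF assms(1,2) _ assms(5)] by simp

text \<open>The exact balance over a cell: \<open>F\<close> is an antiderivative of the right-hand side.\<close>

lemma integral_rhs:
  assumes "solves_bvp \<alpha> \<beta> f u" "C_unit m u" "2 \<le> m" "0 \<le> a" "a \<le> b" "b \<le> 1"
  defines "F \<equiv> \<lambda>x. - nderiv 1 u x + \<alpha> * u x + \<beta> * antideriv u x"
  shows "integral {a<..<b} f = F b - F a"
proof -
  have c: "continuous_on {0..1} u"
    using C_unit_continuous_on[OF assms(2), of 0] by simp
  have "(F has_field_derivative f x) (at x within {0..1})" if "x \<in> {0..1}" for x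
    unfolding F_def bvp_on_closed_interval[OF assms(1-3) that]
    using C_unit_has_field_derivative[OF assms(2), of 1 x]
      C_unit_has_field_derivative[OF assms(2), of 0 x]
      antideriv_has_field_derivative[OF c] that assms(3)
    by (auto intro!: derivative_eq_intros simp: numeral_2_eq_2)
  then have "(F has_vector_derivative f x) (at x within {a..b})" if "x \<in> {a..b}" for x
    using that assms(4-6)
    by (auto simp: has_real_derivative_iff_has_vector_derivative
        intro: has_vector_derivative_within_subset[of _ _ _ "{0..1}"])
  then have "(f has_integral F b - F a) {a..b}"
    using assms(5) by (intro fundamental_theorem_of_calculus)
  then show ?thesis
    by (simp add: integral_open_interval_real[symmetric] integral_unique)
qed

section \<open>Admissible meshes\<close>

lemma admissible_ordered:
  assumes "admissible \<tau>" "1 \<le> i" "i \<le> msize \<tau>"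
  shows "hpt \<tau> (i - 1) < pt \<tau> i" "pt \<tau> i < hpt \<tau> i"
  using assms unfolding admissible_def by simp_all

lemma admissible_end_points:
  assumes "admissible \<tau>"
  shows "pt \<tau> 0 = 0" "hpt \<tau> 0 = 0" "hpt \<tau> (msize \<tau>) = 1" "pt \<tau> (msize \<tau> + 1) = 1"
    "1 \<le> msize \<tau>"
  using assms unfolding admissible_def by simp_all

lemma pt_le_hpt: "admissible \<tau> \<Longrightarrow> i \<le> msize \<tau> \<Longrightarrow> pt \<tau> i \<le> hpt \<tau> i"
  using admissible_ordered(2)[of \<tau> i] admissible_end_points[of \<tau>]
  by (cases "i = 0") auto

lemma hpt_le_pt_Suc: "admissible \<tau> \<Longrightarrow> i \<le> msize \<tau> \<Longrightarrow> hpt \<tau> i \<le> pt \<tau> (Suc i)"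
  using admissible_ordered(1)[of \<tau> "Suc i"] admissible_end_points[of \<tau>]
  by (cases "i = msize \<tau>") auto

lemma hcell_le_meshsize: "i \<in> {1..msize \<tau>} \<Longrightarrow> hcell \<tau> i \<le> meshsize \<tau>"
  unfolding meshsize_def by (intro Max_ge) auto

lemma hplus_bounds:
  assumes "admissible \<tau>" "i \<le> msize \<tau>"
  shows "0 \<le> hplus \<tau> i" "hplus \<tau> i \<le> meshsize \<tau>"
proof -
  show "0 \<le> hplus \<tau> i" using pt_le_hpt[OF assms] by (simp add: hplus_def)
  show "hplus \<tau> i \<le> meshsize \<tau>"
  proof (cases "i = 0")
    case True
    have "0 < hcell \<tau> 1" "hcell \<tau> 1 \<le> meshsize \<tau>"
      using hcell_pos[OF assms(1)] hcell_le_meshsize admissible_end_points(5)[OF assms(1)]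
      by auto
    then show ?thesis
      using True admissible_end_points[OF assms(1)] by (simp add: hplus_def)
  next
    case False
    then show ?thesis
      using hcell_le_meshsize[of i \<tau>] assms admissible_ordered(1)[OF assms(1), of i]
      by (simp add: hplus_def hcell_def)
  qed
qed

lemma hminus_bounds:
  assumes "admissible \<tau>" "i \<le> msize \<tau>"
  shows "0 \<le> hminus \<tau> (Suc i)" "hminus \<tau> (Suc i) \<le> meshsize \<tau>"
proof -
  show "0 \<le> hminus \<tau> (Suc i)" using hpt_le_pt_Suc[OF assms] by (simp add: hminus_def)
  show "hminus \<tau> (Suc i) \<le> meshsize \<tau>"
  proof (cases "i = msize \<tau>")
    case True
    have "0 < hcell \<tau> 1" "hcell \<tau> 1 \<le> meshsize \<tau>"
      using hcell_pos[OF assms(1)] hcell_le_meshsize admissible_end_points(5)[OF assms(1)]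
      by auto
    then show ?thesis
      using True admissible_end_points[OF assms(1)] by (simp add: hminus_def)
  next
    case False
    then show ?thesis
      using hcell_le_meshsize[of "Suc i" \<tau>] assms admissible_ordered(2)[OF assms(1), of "Suc i"]
      by (simp add: hminus_def hcell_def)
  qed
qed

lemma hhalf_eq: "hhalf \<tau> i = hplus \<tau> i + hminus \<tau> (Suc i)"
  by (simp add: hhalf_def hplus_def hminus_def)

lemma hcell_eq: "hcell \<tau> i = hplus \<tau> i + hminus \<tau> i"
  by (simp add: hcell_def hplus_def hminus_def)

lemma sum_hhalf:
  assumes "admissible \<tau>"
  shows "(\<Sum>i = 0..msize \<tau>. hhalf \<tau> i) = 1"
proof -
  have "(\<Sum>i = 0..n. hhalf \<tau> i) = pt \<tau> (Suc n) - pt \<tau> 0" for n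
    by (induction n) (auto simp: hhalf_def)
  then show ?thesis using admissible_end_points[OF assms] by simp
qed

lemma pt_mono:
  assumes "admissible \<tau>" "i \<le> j" "j \<le> Suc (msize \<tau>)"
  shows "pt \<tau> i \<le> pt \<tau> j"
  using assms(2,3)
proof (induction j rule: dec_induct)
  case (step n)
  then show ?case using hhalf_pos[OF assms(1), of n] by (simp add: hhalf_def)
qed simp

lemma pt_in_unit: "admissible \<tau> \<Longrightarrow> i \<le> Suc (msize \<tau>) \<Longrightarrow> pt \<tau> i \<in> {0..1}"
  using pt_mono[of \<tau> 0 i] pt_mono[of \<tau> i "Suc (msize \<tau>)"] admissible_end_points[of \<tau>] by simp

lemma hpt_in_unit: "admissible \<tau> \<Longrightarrow> i \<le> msize \<tau> \<Longrightarrow> hpt \<tau> i \<in> {0..1}"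
  using pt_le_hpt[of \<tau> i] hpt_le_pt_Suc[of \<tau> i] pt_in_unit[of \<tau> i] pt_in_unit[of \<tau> "Suc i"]
  by simp

lemma meshsize_bounds:
  assumes "admissible \<tau>"
  shows "0 < meshsize \<tau>" "meshsize \<tau> \<le> 1"
proof -
  have N: "1 \<in> {1..msize \<tau>}" using admissible_end_points(5)[OF assms] by simp
  show "0 < meshsize \<tau>"
    using hcell_pos[OF assms N] hcell_le_meshsize[OF N] by linarith
  have "hcell \<tau> i \<le> 1" if "i \<in> {1..msize \<tau>}" for i
  proof -
    have "hpt \<tau> i \<le> 1" "0 \<le> hpt \<tau> (i - 1)"
      using hpt_in_unit[OF assms, of i] hpt_in_unit[OF assms, of "i - 1"] that by auto
    then show ?thesis by (simp add: hcell_def)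
  qed
  then show "meshsize \<tau> \<le> 1"
    unfolding meshsize_def using N by (subst Max_le_iff) auto
qed

section \<open>Weighted mean squares and stability of the scheme\<close>

text \<open>The root mean square with weights $h_{i+1/2}$. The weights add up to one, so bounds at each point pass
  to the mean square with the same constant; for a difference quotient it is the discrete
  $H^1_0$ norm.\<close>

definition wnorm :: "mesh \<Rightarrow> (nat \<Rightarrow> real) \<Rightarrow> real" where
  "wnorm \<tau> g = L2_set (\<lambda>i. sqrt (hhalf \<tau> i) * g i) {0..msize \<tau>}"

lemma wnorm_nonneg [simp]: "0 \<le> wnorm \<tau> g"
  by (simp add: wnorm_def)

lemma wnorm_add: "wnorm \<tau> (\<lambda>i. g i + g' i) \<le> wnorm \<tau> g + wnorm \<tau> g'"
  unfolding wnorm_def distrib_left by (rule L2_set_triangle_ineq)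

lemma wnorm_mono_scaled:
  assumes "admissible \<tau>" "0 \<le> C" "\<And>i. i \<le> msize \<tau> \<Longrightarrow> \<bar>g i\<bar> \<le> C * \<bar>g' i\<bar>"
  shows "wnorm \<tau> g \<le> C * wnorm \<tau> g'"
proof -
  have "wnorm \<tau> g = L2_set (\<lambda>i. sqrt (hhalf \<tau> i) * \<bar>g i\<bar>) {0..msize \<tau>}"
    by (simp add: wnorm_def L2_set_def power_mult_distrib)
  also have "\<dots> \<le> L2_set (\<lambda>i. C * (sqrt (hhalf \<tau> i) * \<bar>g' i\<bar>)) {0..msize \<tau>}"
  proof (rule L2_set_mono)
    fix i assume i: "i \<in> {0..msize \<tau>}"
    then have "sqrt (hhalf \<tau> i) * \<bar>g i\<bar> \<le> sqrt (hhalf \<tau> i) * (C * \<bar>g' i\<bar>)"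
      using assms(3) hhalf_pos[OF assms(1), of i] by (intro mult_left_mono) auto
    then show "sqrt (hhalf \<tau> i) * \<bar>g i\<bar> \<le> C * (sqrt (hhalf \<tau> i) * \<bar>g' i\<bar>)"
      by (simp add: algebra_simps)
    show "0 \<le> sqrt (hhalf \<tau> i) * \<bar>g i\<bar>"
      using i hhalf_pos[OF assms(1), of i] by simp
  qed
  also have "\<dots> = C * L2_set (\<lambda>i. sqrt (hhalf \<tau> i) * \<bar>g' i\<bar>) {0..msize \<tau>}"
    using assms(2) by (rule L2_set_right_distrib[symmetric])
  also have "L2_set (\<lambda>i. sqrt (hhalf \<tau> i) * \<bar>g' i\<bar>) {0..msize \<tau>} = wnorm \<tau> g'"
    by (simp add: wnorm_def L2_set_def power_mult_distrib)
  finally show ?thesis .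
qed

lemma wnorm_square:
  assumes "admissible \<tau>"
  shows "(wnorm \<tau> g)\<^sup>2 = (\<Sum>i = 0..msize \<tau>. hhalf \<tau> i * (g i)\<^sup>2)"
proof -
  have "(\<Sum>i = 0..msize \<tau>. (sqrt (hhalf \<tau> i) * g i)\<^sup>2) = (\<Sum>i = 0..msize \<tau>. hhalf \<tau> i * (g i)\<^sup>2)"
    using hhalf_pos[OF assms]
    by (intro sum.cong) (auto simp: power_mult_distrib intro!: real_sqrt_pow2 less_imp_le)
  moreover have "0 \<le> (\<Sum>i = 0..msize \<tau>. (sqrt (hhalf \<tau> i) * g i)\<^sup>2)"
    by (intro sum_nonneg) auto
  ultimately show ?thesis
    unfolding wnorm_def L2_set_def by simp
qed

lemma wnorm_const: 
  assumes "admissible \<tau>" 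
  shows "wnorm \<tau> (\<lambda>i. 1) = 1"
proof -
  have "(wnorm \<tau> (\<lambda>i. 1))\<^sup>2 = 1"
    by (simp add: wnorm_square[OF assms] sum_hhalf[OF assms])
  then show ?thesis using wnorm_nonneg[of \<tau> "\<lambda>i. 1"] by (auto simp: power2_eq_1_iff)
qed

lemma weighted_Cauchy_Schwarz:
  assumes "admissible \<tau>"
  shows "(\<Sum>i = 0..msize \<tau>. hhalf \<tau> i * (\<bar>g i\<bar> * \<bar>g' i\<bar>)) \<le> wnorm \<tau> g * wnorm \<tau> g'"
proof -
  have "(\<Sum>i = 0..msize \<tau>. hhalf \<tau> i * (\<bar>g i\<bar> * \<bar>g' i\<bar>))
    = (\<Sum>i = 0..msize \<tau>. \<bar>sqrt (hhalf \<tau> i) * g i\<bar> * \<bar>sqrt (hhalf \<tau> i) * g' i\<bar>)"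
  proof (rule sum.cong[OF refl])
    fix i assume "i \<in> {0..msize \<tau>}"
    then have "sqrt (hhalf \<tau> i) * sqrt (hhalf \<tau> i) = hhalf \<tau> i" "0 \<le> sqrt (hhalf \<tau> i)"
      using hhalf_pos[OF assms, of i] by auto
    then show "hhalf \<tau> i * (\<bar>g i\<bar> * \<bar>g' i\<bar>)
        = \<bar>sqrt (hhalf \<tau> i) * g i\<bar> * \<bar>sqrt (hhalf \<tau> i) * g' i\<bar>"
      by (simp add: abs_mult algebra_simps) 
  qed
  also have "\<dots> \<le> wnorm \<tau> g * wnorm \<tau> g'"
    unfolding wnorm_def by (rule L2_set_mult_ineq)
  finally show ?thesis .
qed

lemma weighted_sum_le_wnorm:
  "admissible \<tau> \<Longrightarrow> (\<Sum>i = 0..msize \<tau>. hhalf \<tau> i * \<bar>g i\<bar>) \<le> wnorm \<tau> g"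
  using weighted_Cauchy_Schwarz[of \<tau> g "\<lambda>i. 1"] wnorm_const[of \<tau>] by simp

lemma diff_eq_hhalf_dquot:
  "admissible \<tau> \<Longrightarrow> i \<le> msize \<tau> \<Longrightarrow> v (Suc i) - v i = hhalf \<tau> i * dquot \<tau> v i"
  using hhalf_pos[of \<tau> i] by (simp add: dquot_def)

lemma discrete_H10_norm_eq_wnorm:
  assumes "admissible \<tau>"
  shows "discrete_H10_norm \<tau> v = wnorm \<tau> (dquot \<tau> v)"
proof -
  have "(\<Sum>i = 0..msize \<tau>. (v (i + 1) - v i)\<^sup>2 / hhalf \<tau> i)
      = (\<Sum>i = 0..msize \<tau>. hhalf \<tau> i * (dquot \<tau> v i)\<^sup>2)"
    using hhalf_pos[OF assms]
    by (intro sum.cong) (auto simp: dquot_def power2_eq_square divide_simps)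
  then show ?thesis
    unfolding discrete_H10_norm_def wnorm_square[OF assms, symmetric] by simp
qed

text \<open>The increments of \<open>v\<close> are $h_{i+1/2}$ times its difference quotients, and the weights have
  total mass one.\<close>

lemma discrete_Poincare:
  assumes "admissible \<tau>" "v 0 = 0" "i \<le> Suc (msize \<tau>)"
  shows "\<bar>v i\<bar> \<le> wnorm \<tau> (dquot \<tau> v)"
proof -
  have "\<bar>v i\<bar> = \<bar>\<Sum>j<i. v (Suc j) - v j\<bar>"
    using assms(2) by (simp add: sum_lessThan_telescope)
  also have "\<dots> \<le> (\<Sum>j<i. \<bar>v (Suc j) - v j\<bar>)" by (rule sum_abs)
  also have "\<dots> \<le> (\<Sum>j = 0..msize \<tau>. \<bar>v (Suc j) - v j\<bar>)"
    using assms(3) by (intro sum_mono2) auto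
  also have "\<dots> = (\<Sum>j = 0..msize \<tau>. hhalf \<tau> j * \<bar>dquot \<tau> v j\<bar>)"
    using hhalf_pos[OF assms(1)]
    by (intro sum.cong) (auto simp: diff_eq_hhalf_dquot[OF assms(1)] abs_mult less_imp_le)
  also have "\<dots> \<le> wnorm \<tau> (dquot \<tau> v)" by (rule weighted_sum_le_wnorm[OF assms(1)])
  finally show ?thesis .
qed

lemma summation_by_parts:
  fixes X e :: "nat \<Rightarrow> real"
  shows "(\<Sum>i = 1..n. e i * (X i - X (i - 1))) =
    X n * e (Suc n) - X 0 * e 0 - (\<Sum>i = 0..n. X i * (e (Suc i) - e i))"
  by (induction n) (auto simp: algebra_simps)

text \<open>The upwind difference dominates half of a telescoping sum of squares, since
  $2a(a-b) = a^2 - b^2 + (a-b)^2$.\<close>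

lemma convection_nonneg:
  fixes e :: "nat \<Rightarrow> real"
  assumes "e 0 = 0"
  shows "0 \<le> (\<Sum>i = 1..n. e i * (e i - e (i - 1)))"
proof -
  have "(e n)\<^sup>2 / 2 \<le> (\<Sum>i = 1..n. e i * (e i - e (i - 1)))"
  proof (induction n)
    case (Suc n)
    have "(e (Suc n))\<^sup>2 / 2 - (e n)\<^sup>2 / 2 \<le> e (Suc n) * (e (Suc n) - e n)"
      using sum_squares_ge_zero[of "e (Suc n) - e n" 0]
      by (simp add: power2_eq_square algebra_simps)
    then show ?case using Suc by simp
  qed (simp add: assms)
  moreover have "0 \<le> (e n)\<^sup>2 / 2" by simp
  ultimately show ?thesis by linarith
qed

text \<open>Test the equation with \<open>e\<close>. The diffusion term gives the square of the norm, convection and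
  reaction are nonnegative. The difference of \<open>G\<close> is summed by parts and paired with the difference
  quotient by Cauchy-Schwarz; \<open>T\<close> is paired with the maximum of \<open>e\<close>, which the norm bounds.
  Then one factor of the norm is cancelled.\<close>

lemma fv_stability:
  assumes "0 \<le> \<alpha>" "0 \<le> \<beta>" "admissible \<tau>"
    and "e 0 = 0" "e (Suc (msize \<tau>)) = 0"
    and eq: "\<And>i. i \<in> {1..msize \<tau>} \<Longrightarrow> fv_op \<alpha> \<beta> \<tau> e i = G i - G (i - 1) + T i"
  shows "wnorm \<tau> (dquot \<tau> e) \<le> wnorm \<tau> G + (\<Sum>i = 1..msize \<tau>. \<bar>T i\<bar>)"
proof -
  define N where "N = msize \<tau>"
  define d where "d = dquot \<tau> e"
  have step: "e (Suc i) - e i = hhalf \<tau> i * d i" if "i \<in> {0..N}" for i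
    using that diff_eq_hhalf_dquot[OF assms(3)] by (simp add: N_def d_def)
  have diffusion: "(wnorm \<tau> d)\<^sup>2 = - (\<Sum>i = 1..N. e i * (d i - d (i - 1)))"
    unfolding summation_by_parts wnorm_square[OF assms(3)] N_def[symmetric]
    using assms(4,5) step by (simp add: N_def power2_eq_square mult_ac)
  have reaction: "0 \<le> (\<Sum>i = 1..N. \<beta> * hcell \<tau> i * (e i)\<^sup>2)"
    using assms(2) hcell_pos[OF assms(3)] unfolding N_def
    by (intro sum_nonneg) (simp add: less_imp_le)
  have "(\<Sum>i = 1..N. e i * fv_op \<alpha> \<beta> \<tau> e i) = (wnorm \<tau> d)\<^sup>2
      + \<alpha> * (\<Sum>i = 1..N. e i * (e i - e (i - 1))) + (\<Sum>i = 1..N. \<beta> * hcell \<tau> i * (e i)\<^sup>2)"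
    unfolding diffusion fv_op_def d_def[symmetric] sum_distrib_left
      sum_negf[symmetric] sum.distrib[symmetric]
    by (intro sum.cong) (auto simp: algebra_simps power2_eq_square)
  then have "(wnorm \<tau> d)\<^sup>2 \<le> (\<Sum>i = 1..N. e i * fv_op \<alpha> \<beta> \<tau> e i)"
    using convection_nonneg[of e N] assms(1,4) reaction by simp
  also have "\<dots> = (\<Sum>i = 1..N. e i * (G i - G (i - 1))) + (\<Sum>i = 1..N. e i * T i)"
    unfolding sum.distrib[symmetric] distrib_left[symmetric]
    by (intro sum.cong refl arg_cong2[where f = "(*)"] eq) (simp add: N_def)
  also have "(\<Sum>i = 1..N. e i * (G i - G (i - 1))) \<le> wnorm \<tau> G * wnorm \<tau> d"
  proof -
    have "(\<Sum>i = 1..N. e i * (G i - G (i - 1))) = (\<Sum>i = 0..N. hhalf \<tau> i * - (G i * d i))"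
      unfolding summation_by_parts using assms(4,5) step
      by (simp add: N_def sum_negf[symmetric] mult_ac)
    also have "\<dots> \<le> (\<Sum>i = 0..N. hhalf \<tau> i * (\<bar>G i\<bar> * \<bar>d i\<bar>))"
      using hhalf_pos[OF assms(3)]
      by (intro sum_mono mult_left_mono)
        (auto simp: N_def less_imp_le abs_mult[symmetric] abs_ge_minus_self)
    also have "\<dots> \<le> wnorm \<tau> G * wnorm \<tau> d"
      unfolding N_def by (rule weighted_Cauchy_Schwarz[OF assms(3)])
    finally show ?thesis .
  qed
  also have "(\<Sum>i = 1..N. e i * T i) \<le> (\<Sum>i = 1..N. wnorm \<tau> d * \<bar>T i\<bar>)"
  proof (rule sum_mono)
    fix i assume "i \<in> {1..N}"
    then have "\<bar>e i\<bar> \<le> wnorm \<tau> d"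
      unfolding d_def N_def using assms(3,4) by (intro discrete_Poincare) auto
    then have "\<bar>e i\<bar> * \<bar>T i\<bar> \<le> wnorm \<tau> d * \<bar>T i\<bar>" by (rule mult_right_mono) simp
    then show "e i * T i \<le> wnorm \<tau> d * \<bar>T i\<bar>"
      using abs_ge_self[of "e i * T i"] by (simp add: abs_mult)
  qed
  finally have "wnorm \<tau> d * wnorm \<tau> d \<le> (wnorm \<tau> G + (\<Sum>i = 1..N. \<bar>T i\<bar>)) * wnorm \<tau> d"
    by (simp add: power2_eq_square sum_distrib_left algebra_simps)
  then show ?thesis
    using wnorm_nonneg[of \<tau> d] unfolding d_def[symmetric] N_def[symmetric]
    by (cases "wnorm \<tau> d = 0") (auto simp: sum_nonneg)
qed

section \<open>Orders of magnitude\<close>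

text \<open>Quantities that depend on the mesh only. The bound is uniform over all meshes and all
  indices.\<close>

definition coeff_order :: "nat \<Rightarrow> (mesh \<Rightarrow> nat \<Rightarrow> real) \<Rightarrow> bool" where
  "coeff_order q c \<longleftrightarrow>
     (\<exists>C\<ge>0. \<forall>\<tau> i. admissible \<tau> \<and> i \<le> msize \<tau> \<longrightarrow> \<bar>c \<tau> i\<bar> \<le> C * meshsize \<tau> ^ q)"

lemma coeff_orderI:
  assumes "0 \<le> C"
    and "\<And>\<tau> i. admissible \<tau> \<Longrightarrow> i \<le> msize \<tau> \<Longrightarrow> \<bar>c \<tau> i\<bar> \<le> C * meshsize \<tau> ^ q"
  shows "coeff_order q c"
  using assms unfolding coeff_order_def by blast

lemma coeff_orderE:
  assumes "coeff_order q c"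
  obtains C where "0 \<le> C"
    "\<And>\<tau> i. admissible \<tau> \<Longrightarrow> i \<le> msize \<tau> \<Longrightarrow> \<bar>c \<tau> i\<bar> \<le> C * meshsize \<tau> ^ q"
  using assms unfolding coeff_order_def by blast

lemma coeff_order_const: "coeff_order 0 (\<lambda>\<tau> i. a)"
  by (rule coeff_orderI[of "\<bar>a\<bar>"]) auto

lemma coeff_order_mult:
  assumes "coeff_order p a" "coeff_order q b"
  shows "coeff_order (p + q) (\<lambda>\<tau> i. a \<tau> i * b \<tau> i)"
proof -
  from assms(1) obtain A where A: "0 \<le> A"
    "\<And>\<tau> i. admissible \<tau> \<Longrightarrow> i \<le> msize \<tau> \<Longrightarrow> \<bar>a \<tau> i\<bar> \<le> A * meshsize \<tau> ^ p"
    by (rule coeff_orderE) blast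
  from assms(2) obtain B where B: "0 \<le> B"
    "\<And>\<tau> i. admissible \<tau> \<Longrightarrow> i \<le> msize \<tau> \<Longrightarrow> \<bar>b \<tau> i\<bar> \<le> B * meshsize \<tau> ^ q"
    by (rule coeff_orderE) blast
  show ?thesis
  proof (rule coeff_orderI[of "A * B"])
    fix \<tau> i assume *: "admissible \<tau>" "i \<le> msize \<tau>"
    have "\<bar>a \<tau> i\<bar> * \<bar>b \<tau> i\<bar> \<le> (A * meshsize \<tau> ^ p) * (B * meshsize \<tau> ^ q)"
      using A B * meshsize_bounds[OF *(1)] by (intro mult_mono) auto
    then show "\<bar>a \<tau> i * b \<tau> i\<bar> \<le> A * B * meshsize \<tau> ^ (p + q)"
      by (simp add: abs_mult power_add mult_ac)
  qed (use A B in simp)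
qed

lemma coeff_order_add:
  assumes "coeff_order q a" "coeff_order q b"
  shows "coeff_order q (\<lambda>\<tau> i. a \<tau> i + b \<tau> i)"
proof -
  from assms(1) obtain A where A: "0 \<le> A"
    "\<And>\<tau> i. admissible \<tau> \<Longrightarrow> i \<le> msize \<tau> \<Longrightarrow> \<bar>a \<tau> i\<bar> \<le> A * meshsize \<tau> ^ q"
    by (rule coeff_orderE) blast
  from assms(2) obtain B where B: "0 \<le> B"
    "\<And>\<tau> i. admissible \<tau> \<Longrightarrow> i \<le> msize \<tau> \<Longrightarrow> \<bar>b \<tau> i\<bar> \<le> B * meshsize \<tau> ^ q"
    by (rule coeff_orderE) blast
  show ?thesis
  proof (rule coeff_orderI[of "A + B"])
    fix \<tau> i assume *: "admissible \<tau>" "i \<le> msize \<tau>"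
    show "\<bar>a \<tau> i + b \<tau> i\<bar> \<le> (A + B) * meshsize \<tau> ^ q"
      using A(2)[OF *] B(2)[OF *] unfolding distrib_right by linarith
  qed (use A B in simp)
qed

lemma coeff_order_sum:
  assumes "finite I" "\<And>m. m \<in> I \<Longrightarrow> coeff_order q (c m)"
  shows "coeff_order q (\<lambda>\<tau> i. \<Sum>m\<in>I. c m \<tau> i)"
  using assms
proof (induction I)
  case empty
  show ?case by (rule coeff_orderI[of 0]) auto
next
  case (insert m I)
  then show ?case by (simp add: coeff_order_add)
qed

lemma coeff_order_uminus: "coeff_order q c \<Longrightarrow> coeff_order q (\<lambda>\<tau> i. - c \<tau> i)"
  by (simp add: coeff_order_def)

lemma coeff_order_scale: "coeff_order q c \<Longrightarrow> coeff_order q (\<lambda>\<tau> i. a * c \<tau> i)"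
  using coeff_order_mult[OF coeff_order_const] by simp

lemma coeff_order_divide: "coeff_order q c \<Longrightarrow> coeff_order q (\<lambda>\<tau> i. c \<tau> i / a)"
  using coeff_order_scale[of q c "1 / a"] by simp

lemma coeff_order_power: "coeff_order 1 c \<Longrightarrow> coeff_order n (\<lambda>\<tau> i. c \<tau> i ^ n)"
proof (induction n)
  case 0
  show ?case using coeff_order_const[of 1] by simp
next
  case (Suc n)
  then show ?case using coeff_order_mult[of 1 c n "\<lambda>\<tau> i. c \<tau> i ^ n"] by simp
qed

lemma coeff_order_hplus: "coeff_order 1 hplus"
  by (rule coeff_orderI[of 1]) (auto simp: hplus_bounds)

lemma coeff_order_hminus: "coeff_order 1 (\<lambda>\<tau> i. hminus \<tau> (Suc i))"
  by (rule coeff_orderI[of 1]) (auto simp: hminus_bounds)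

lemma coeff_order_hhalf: "coeff_order 1 hhalf"
  using coeff_order_add[OF coeff_order_hplus coeff_order_hminus] unfolding hhalf_eq[symmetric] .

lemma coeff_order_amesh: "coeff_order (m - 1) (\<lambda>\<tau> i. amesh \<tau> i m)"
proof -
  have "coeff_order (m - 1)
      (\<lambda>\<tau> i. hminus \<tau> (Suc i) ^ j * (- hplus \<tau> i) ^ (m - 1 - j))" if "j \<in> {0..m - 1}" for j
  proof -
    have "j + (m - 1 - j) = m - 1" using that by simp
    then show ?thesis
      using coeff_order_mult[OF coeff_order_power[OF coeff_order_hminus]
          coeff_order_power[OF coeff_order_uminus[OF coeff_order_hplus]], of j "m - 1 - j"]
      by simp
  qed
  then show ?thesis
    unfolding amesh_def by (intro coeff_order_scale coeff_order_sum) auto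
qed

text \<open>The reaction terms are summed without weights; dividing by $h_{i+1/2}$ creates the weight at the
  cost of one power of a length that $h_{i+1/2}$ dominates.\<close>

lemma coeff_order_power_div_hhalf:
  assumes "coeff_order 1 c"
    and "\<And>\<tau> i. admissible \<tau> \<Longrightarrow> i \<le> msize \<tau> \<Longrightarrow> \<bar>c \<tau> i\<bar> \<le> hhalf \<tau> i"
  shows "coeff_order m (\<lambda>\<tau> i. c \<tau> i ^ (m + 1) / hhalf \<tau> i)"
proof -
  from coeff_order_power[OF assms(1)] obtain C where C: "0 \<le> C"
    "\<And>\<tau> i. admissible \<tau> \<Longrightarrow> i \<le> msize \<tau> \<Longrightarrow> \<bar>c \<tau> i ^ m\<bar> \<le> C * meshsize \<tau> ^ m"
    by (rule coeff_orderE) blast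
  show ?thesis
  proof (rule coeff_orderI[OF C(1)])
    fix \<tau> i assume *: "admissible \<tau>" "i \<le> msize \<tau>"
    have "\<bar>c \<tau> i ^ m * (c \<tau> i / hhalf \<tau> i)\<bar> \<le> \<bar>c \<tau> i ^ m\<bar> * 1"
      unfolding abs_mult using assms(2)[OF *] hhalf_pos[OF *]
      by (intro mult_left_mono) auto
    then show "\<bar>c \<tau> i ^ (m + 1) / hhalf \<tau> i\<bar> \<le> C * meshsize \<tau> ^ m"
      using C(2)[OF *] by (simp add: mult.commute)
  qed
qed

text \<open>Families of mesh functions indexed by the solution, the right-hand side and the mesh.\<close>

type_synonym quantity = "(real \<Rightarrow> real) \<Rightarrow> (real \<Rightarrow> real) \<Rightarrow> mesh \<Rightarrow> nat \<Rightarrow> real"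

locale corrected_scheme =
  fixes \<alpha> \<beta> :: real and K :: nat
  assumes \<alpha>_nonneg: "0 \<le> \<alpha>" and \<beta>_nonneg: "0 \<le> \<beta>"
begin

definition problem :: "(real \<Rightarrow> real) \<Rightarrow> (real \<Rightarrow> real) \<Rightarrow> mesh \<Rightarrow> bool" where
  "problem u f \<tau> \<longleftrightarrow> solves_bvp \<alpha> \<beta> f u \<and> C_unit (K + 2) u \<and> admissible \<tau>"

text \<open>The regularity $C^{K+2}$ is fixed once for all levels up to \<open>K\<close>, so that the induction over the
  levels compares orders with respect to a single norm of \<open>u\<close>.\<close>

definition mean_order :: "nat \<Rightarrow> quantity \<Rightarrow> bool" where
  "mean_order q g \<longleftrightarrow> (\<exists>C\<ge>0. \<forall>u f \<tau>. problem u f \<tau> \<longrightarrow>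
     wnorm \<tau> (g u f \<tau>) \<le> C * (meshsize \<tau> ^ q * C_norm (K + 2) u))"

lemma mean_orderI:
  assumes "0 \<le> C" and "\<And>u f \<tau>. problem u f \<tau> \<Longrightarrow>
    wnorm \<tau> (g u f \<tau>) \<le> C * (meshsize \<tau> ^ q * C_norm (K + 2) u)"
  shows "mean_order q g"
  using assms unfolding mean_order_def by blast

lemma mean_orderE:
  assumes "mean_order q g"
  obtains C where "0 \<le> C" "\<And>u f \<tau>. problem u f \<tau> \<Longrightarrow>
    wnorm \<tau> (g u f \<tau>) \<le> C * (meshsize \<tau> ^ q * C_norm (K + 2) u)"
  using assms unfolding mean_order_def by blast

lemma problemD:
  assumes "problem u f \<tau>"
  shows "solves_bvp \<alpha> \<beta> f u" "C_unit (K + 2) u" "admissible \<tau>"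
  using assms by (auto simp: problem_def)

lemma problem_nonneg: "problem u f \<tau> \<Longrightarrow> 0 \<le> meshsize \<tau> ^ q * C_norm (K + 2) u"
  using meshsize_bounds[of \<tau>] C_norm_nonneg[of "K + 2" u] by (auto simp: problem_def)

lemma mean_order_cong:
  assumes "\<And>u f \<tau> i. problem u f \<tau> \<Longrightarrow> i \<le> msize \<tau> \<Longrightarrow> g u f \<tau> i = g' u f \<tau> i"
    and "mean_order q g'"
  shows "mean_order q g"
proof -
  have "wnorm \<tau> (g u f \<tau>) = wnorm \<tau> (g' u f \<tau>)" if "problem u f \<tau>" for u f \<tau>
    unfolding wnorm_def using assms(1)[OF that] by (intro L2_set_cong) auto
  then show ?thesis using assms(2) unfolding mean_order_def by simp
qed

lemma mean_order_max:
  assumes "0 \<le> C" and "\<And>u f \<tau> i. problem u f \<tau> \<Longrightarrow> i \<le> msize \<tau> \<Longrightarrow>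
    \<bar>g u f \<tau> i\<bar> \<le> C * (meshsize \<tau> ^ q * C_norm (K + 2) u)"
  shows "mean_order q g"
proof (rule mean_orderI[OF assms(1)])
  fix u f \<tau> assume *: "problem u f \<tau>"
  have "wnorm \<tau> (g u f \<tau>) \<le> C * (meshsize \<tau> ^ q * C_norm (K + 2) u) * wnorm \<tau> (\<lambda>i. 1)"
    using assms * problem_nonneg[OF *] by (intro wnorm_mono_scaled) (auto simp: problem_def)
  then show "wnorm \<tau> (g u f \<tau>) \<le> C * (meshsize \<tau> ^ q * C_norm (K + 2) u)"
    using wnorm_const[of \<tau>] * by (simp add: problem_def)
qed

lemma mean_order_add:
  assumes "mean_order q g" "mean_order q g'"
  shows "mean_order q (\<lambda>u f \<tau> i. g u f \<tau> i + g' u f \<tau> i)"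
proof -
  from assms(1) obtain A where A: "0 \<le> A" "\<And>u f \<tau>. problem u f \<tau> \<Longrightarrow>
      wnorm \<tau> (g u f \<tau>) \<le> A * (meshsize \<tau> ^ q * C_norm (K + 2) u)"
    by (rule mean_orderE) blast
  from assms(2) obtain B where B: "0 \<le> B" "\<And>u f \<tau>. problem u f \<tau> \<Longrightarrow>
      wnorm \<tau> (g' u f \<tau>) \<le> B * (meshsize \<tau> ^ q * C_norm (K + 2) u)"
    by (rule mean_orderE) blast
  show ?thesis
  proof (rule mean_orderI[of "A + B"])
    fix u f \<tau> assume *: "problem u f \<tau>"
    show "wnorm \<tau> (\<lambda>i. g u f \<tau> i + g' u f \<tau> i)
        \<le> (A + B) * (meshsize \<tau> ^ q * C_norm (K + 2) u)"
      using A(2)[OF *] B(2)[OF *] wnorm_add[of \<tau> "g u f \<tau>" "g' u f \<tau>"]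
      unfolding distrib_right by linarith
  qed (use A B in simp)
qed

lemma mean_order_sum:
  assumes "finite I" "\<And>m. m \<in> I \<Longrightarrow> mean_order q (g m)"
  shows "mean_order q (\<lambda>u f \<tau> i. \<Sum>m\<in>I. g m u f \<tau> i)"
  using assms
proof (induction I)
  case empty
  show ?case by (rule mean_order_max[of 0]) auto
next
  case (insert m I)
  then show ?case by (simp add: mean_order_add)
qed

text \<open>The exponent may be lowered because the mesh size is at most one.\<close>

lemma mean_order_mult:
  assumes "coeff_order p c" "mean_order q g" "r \<le> p + q"
  shows "mean_order r (\<lambda>u f \<tau> i. c \<tau> i * g u f \<tau> i)"
proof -
  from assms(1) obtain A where A: "0 \<le> A"
    "\<And>\<tau> i. admissible \<tau> \<Longrightarrow> i \<le> msize \<tau> \<Longrightarrow> \<bar>c \<tau> i\<bar> \<le> A * meshsize \<tau> ^ p"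
    by (rule coeff_orderE) blast
  from assms(2) obtain B where B: "0 \<le> B" "\<And>u f \<tau>. problem u f \<tau> \<Longrightarrow>
      wnorm \<tau> (g u f \<tau>) \<le> B * (meshsize \<tau> ^ q * C_norm (K + 2) u)"
    by (rule mean_orderE) blast
  show ?thesis
  proof (rule mean_orderI[of "A * B"])
    fix u f \<tau> assume *: "problem u f \<tau>"
    have h: "0 < meshsize \<tau>" "meshsize \<tau> \<le> 1" "0 \<le> C_norm (K + 2) u"
      using meshsize_bounds[of \<tau>] C_norm_nonneg[of "K + 2" u] * by (auto simp: problem_def)
    have "\<bar>c \<tau> i * g u f \<tau> i\<bar> \<le> (A * meshsize \<tau> ^ p) * \<bar>g u f \<tau> i\<bar>" if "i \<le> msize \<tau>" for i
      unfolding abs_mult using A(2)[OF problemD(3)[OF *] that] by (intro mult_right_mono) auto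
    then have "wnorm \<tau> (\<lambda>i. c \<tau> i * g u f \<tau> i) \<le> (A * meshsize \<tau> ^ p) * wnorm \<tau> (g u f \<tau>)"
      using A(1) h problemD(3)[OF *] by (intro wnorm_mono_scaled) auto
    also have "\<dots> \<le> (A * meshsize \<tau> ^ p) * (B * (meshsize \<tau> ^ q * C_norm (K + 2) u))"
      using A(1) h B(2)[OF *] by (intro mult_left_mono) auto
    also have "\<dots> = A * B * (meshsize \<tau> ^ (p + q) * C_norm (K + 2) u)"
      by (simp add: power_add mult_ac)
    also have "\<dots> \<le> A * B * (meshsize \<tau> ^ r * C_norm (K + 2) u)"
      using A(1) B(1) h assms(3)
      by (intro mult_left_mono mult_right_mono power_decreasing) auto
    finally show "wnorm \<tau> (\<lambda>i. c \<tau> i * g u f \<tau> i) \<le> \<dots>" .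
  qed (use A B in simp)
qed

lemma mean_order_scale: "mean_order q g \<Longrightarrow> mean_order q (\<lambda>u f \<tau> i. a * g u f \<tau> i)"
  by (rule mean_order_mult[OF coeff_order_const]) auto

lemma mean_order_weaken: "mean_order q g \<Longrightarrow> r \<le> q \<Longrightarrow> mean_order r g"
  using mean_order_mult[OF coeff_order_const[of 1], of q g r] by simp

lemma mean_order_diff:
  assumes "mean_order q g" "mean_order q g'"
  shows "mean_order q (\<lambda>u f \<tau> i. g u f \<tau> i - g' u f \<tau> i)"
  using mean_order_add[OF assms(1) mean_order_scale[OF assms(2), of "-1"]] by simp

section \<open>Truncation errors of the Taylor expansions\<close>

lemma pt_unit: "problem u f \<tau> \<Longrightarrow> i \<le> msize \<tau> \<Longrightarrow> pt \<tau> i \<in> {0..1}"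
  by (intro pt_in_unit) (auto simp: problem_def)

lemma pt_Suc_unit: "problem u f \<tau> \<Longrightarrow> i \<le> msize \<tau> \<Longrightarrow> pt \<tau> (Suc i) \<in> {0..1}"
  by (intro pt_in_unit) (auto simp: problem_def)

text \<open>Taylor remainders are bounded by the norm of \<open>u\<close> times a power of a mesh length; \<open>c\<close> stands
  for this power.\<close>

lemma mean_order_remainder:
  assumes "coeff_order q c" "0 \<le> B"
    and "\<And>u f \<tau> i. problem u f \<tau> \<Longrightarrow> i \<le> msize \<tau> \<Longrightarrow>
      \<bar>g u f \<tau> i\<bar> \<le> B * (C_norm (K + 2) u * \<bar>c \<tau> i\<bar>)"
  shows "mean_order q g"
proof -
  from assms(1) obtain A where A: "0 \<le> A"
    "\<And>\<tau> i. admissible \<tau> \<Longrightarrow> i \<le> msize \<tau> \<Longrightarrow> \<bar>c \<tau> i\<bar> \<le> A * meshsize \<tau> ^ q"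
    by (rule coeff_orderE) blast
  show ?thesis
  proof (rule mean_order_max[of "B * A"])
    fix u f \<tau> i assume *: "problem u f \<tau>" "i \<le> msize \<tau>"
    have "B * (C_norm (K + 2) u * \<bar>c \<tau> i\<bar>) \<le> B * (C_norm (K + 2) u * (A * meshsize \<tau> ^ q))"
      using A(2)[OF problemD(3)[OF *(1)] *(2)] C_norm_nonneg[OF problemD(2)[OF *(1)]] assms(2)
      by (intro mult_left_mono) auto
    then show "\<bar>g u f \<tau> i\<bar> \<le> B * A * (meshsize \<tau> ^ q * C_norm (K + 2) u)"
      using assms(3)[OF *] by (simp add: mult_ac)
  qed (use A assms in simp)
qed

lemma mean_order_taylor:
  assumes "coeff_order 1 (\<lambda>\<tau> i. Y \<tau> i - X \<tau> i)" "a + n < K + 2"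
    and "\<And>\<tau> i. admissible \<tau> \<Longrightarrow> i \<le> msize \<tau> \<Longrightarrow> X \<tau> i \<in> {0..1} \<and> Y \<tau> i \<in> {0..1}"
  shows "mean_order (Suc n) (\<lambda>u f \<tau> i. nderiv a u (Y \<tau> i)
    - (\<Sum>j\<le>n. (Y \<tau> i - X \<tau> i) ^ j / fact j * nderiv (a + j) u (X \<tau> i)))"
proof (rule mean_order_remainder[OF coeff_order_power[OF assms(1), of "Suc n"], of 1])
  fix u f \<tau> i assume *: "problem u f \<tau>" "i \<le> msize \<tau>"
  show "\<bar>nderiv a u (Y \<tau> i)
      - (\<Sum>j\<le>n. (Y \<tau> i - X \<tau> i) ^ j / fact j * nderiv (a + j) u (X \<tau> i))\<bar>
    \<le> 1 * (C_norm (K + 2) u * \<bar>(Y \<tau> i - X \<tau> i) ^ Suc n\<bar>)"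
    using taylor_nderiv[OF problemD(2)[OF *(1)] assms(2), of "X \<tau> i" "Y \<tau> i"]
      assms(3)[OF problemD(3)[OF *(1)] *(2)]
    by (simp add: power_abs del: power_Suc)
qed simp

lemma mean_order_taylor_antideriv:
  assumes "coeff_order 1 (\<lambda>\<tau> i. Y \<tau> i - X \<tau> i)" "n < K + 2"
    and "\<And>\<tau> i. admissible \<tau> \<Longrightarrow> i \<le> msize \<tau> \<Longrightarrow> X \<tau> i \<in> {0..1} \<and> Y \<tau> i \<in> {0..1}"
    and "\<And>\<tau> i. admissible \<tau> \<Longrightarrow> i \<le> msize \<tau> \<Longrightarrow> \<bar>Y \<tau> i - X \<tau> i\<bar> \<le> hhalf \<tau> i"
  shows "mean_order (n + 1) (\<lambda>u f \<tau> i. (antideriv u (Y \<tau> i) - antideriv u (X \<tau> i)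
    - (\<Sum>j\<le>n. (Y \<tau> i - X \<tau> i) ^ Suc j / fact (Suc j) * nderiv j u (X \<tau> i))) / hhalf \<tau> i)"
proof (rule mean_order_remainder[OF coeff_order_power_div_hhalf[OF assms(1,4), of "n + 1"], of 1])
  fix u f \<tau> i assume *: "problem u f \<tau>" "i \<le> msize \<tau>"
  note p = problemD[OF *(1)]
  have h: "0 < hhalf \<tau> i" using hhalf_pos[OF p(3) *(2)] .
  have "\<bar>antideriv u (Y \<tau> i) - antideriv u (X \<tau> i)
      - (\<Sum>j\<le>n. (Y \<tau> i - X \<tau> i) ^ Suc j / fact (Suc j) * nderiv j u (X \<tau> i))\<bar>
    \<le> C_norm (K + 2) u * \<bar>Y \<tau> i - X \<tau> i\<bar> ^ (n + 2)"
    using assms(2) assms(3)[OF p(3) *(2)] by (intro taylor_antideriv[OF p(2)]) auto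
  then have "\<bar>antideriv u (Y \<tau> i) - antideriv u (X \<tau> i)
      - (\<Sum>j\<le>n. (Y \<tau> i - X \<tau> i) ^ Suc j / fact (Suc j) * nderiv j u (X \<tau> i))\<bar> / hhalf \<tau> i
    \<le> C_norm (K + 2) u * \<bar>Y \<tau> i - X \<tau> i\<bar> ^ (n + 2) / hhalf \<tau> i"
    using h by (intro divide_right_mono) auto
  then show "\<bar>(antideriv u (Y \<tau> i) - antideriv u (X \<tau> i)
      - (\<Sum>j\<le>n. (Y \<tau> i - X \<tau> i) ^ Suc j / fact (Suc j) * nderiv j u (X \<tau> i))) / hhalf \<tau> i\<bar>
    \<le> 1 * (C_norm (K + 2) u * \<bar>(Y \<tau> i - X \<tau> i) ^ (n + 1 + 1) / hhalf \<tau> i\<bar>)"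
    using h by (simp add: abs_divide power_abs del: power_Suc)
qed simp_all

text \<open>Expand both values in the difference quotient about the same point \<open>Z\<close>; the terms of degree
  zero cancel. It is used with \<open>Z\<close> equal to $x_i$ and to $x_{i+1/2}$.\<close>

lemma mean_order_taylor_dquot:
  assumes "n < K + 2"
    and z: "\<And>\<tau> i. admissible \<tau> \<Longrightarrow> i \<le> msize \<tau> \<Longrightarrow> pt \<tau> i \<le> Z \<tau> i \<and> Z \<tau> i \<le> pt \<tau> (Suc i)"
  shows "mean_order n (\<lambda>u f \<tau> i. dquot \<tau> (\<lambda>i. u (pt \<tau> i)) i
    - (\<Sum>m = 1..n. ((pt \<tau> (Suc i) - Z \<tau> i) ^ m - (pt \<tau> i - Z \<tau> i) ^ m) / hhalf \<tau> i / fact m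
        * nderiv m u (Z \<tau> i)))"
proof (rule mean_order_remainder[OF coeff_order_power[OF coeff_order_hhalf], of 2])
  fix u f \<tau> i assume *: "problem u f \<tau>" "i \<le> msize \<tau>"
  note p = problemD[OF *(1)]
  define H M z where "H = hhalf \<tau> i" and "M = C_norm (K + 2) u" and "z = Z \<tau> i"
  have H: "0 < H" using hhalf_pos[OF p(3) *(2)] by (simp add: H_def)
  have M: "0 \<le> M" using C_norm_nonneg[OF p(2)] by (simp add: M_def)
  define R where "R y = u y - (\<Sum>m\<le>n. (y - z) ^ m / fact m * nderiv m u z)" for y
  have R: "\<bar>R y\<bar> \<le> M * H ^ Suc n" if "y \<in> {pt \<tau> i, pt \<tau> (Suc i)}" for y
  proof -
    have y: "y \<in> {0..1}" "z \<in> {0..1}" "\<bar>y - z\<bar> \<le> H"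
      using that assms(2)[OF p(3) *(2)] pt_unit[OF *] pt_Suc_unit[OF *]
      by (auto simp: H_def hhalf_def z_def)
    have "\<bar>R y\<bar> \<le> M * \<bar>y - z\<bar> ^ Suc n"
      using taylor_nderiv[OF p(2), of 0 n z y] assms(1) y by (simp add: R_def M_def)
    also have "\<dots> \<le> M * H ^ Suc n"
      using y M by (intro mult_left_mono power_mono) auto
    finally show ?thesis .
  qed
  have "dquot \<tau> (\<lambda>i. u (pt \<tau> i)) i
    - (\<Sum>m = 1..n. ((pt \<tau> (Suc i) - z) ^ m - (pt \<tau> i - z) ^ m) / H / fact m * nderiv m u z)
    = (R (pt \<tau> (Suc i)) - R (pt \<tau> i)) / H"
  proof -
    have "R (pt \<tau> (Suc i)) - R (pt \<tau> i) = u (pt \<tau> (Suc i)) - u (pt \<tau> i)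
      - (\<Sum>m = 0..n. ((pt \<tau> (Suc i) - z) ^ m - (pt \<tau> i - z) ^ m) / fact m * nderiv m u z)"
      unfolding R_def atMost_atLeast0
      by (simp add: sum_subtractf algebra_simps diff_divide_distrib)
    also have "(\<Sum>m = 0..n. ((pt \<tau> (Suc i) - z) ^ m - (pt \<tau> i - z) ^ m) / fact m * nderiv m u z)
      = (\<Sum>m = 1..n. ((pt \<tau> (Suc i) - z) ^ m - (pt \<tau> i - z) ^ m) / fact m * nderiv m u z)"
      by (subst sum.atLeast_Suc_atMost) auto
    finally show ?thesis
      by (simp add: dquot_def H_def[symmetric] diff_divide_distrib sum_divide_distrib
          right_diff_distrib mult_ac)
  qed
  also have "\<bar>\<dots>\<bar> \<le> (M * H ^ Suc n + M * H ^ Suc n) / H"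
  proof -
    have "\<bar>R (pt \<tau> i)\<bar> \<le> M * H ^ Suc n" "\<bar>R (pt \<tau> (Suc i))\<bar> \<le> M * H ^ Suc n"
      by (rule R; simp)+
    then have "\<bar>R (pt \<tau> (Suc i)) - R (pt \<tau> i)\<bar> \<le> M * H ^ Suc n + M * H ^ Suc n"
      by linarith
    then show ?thesis
      using H by (simp add: abs_divide divide_right_mono del: power_Suc)
  qed
  also have "\<dots> = 2 * (M * \<bar>H ^ n\<bar>)"
    using H by simp
  finally show "\<bar>dquot \<tau> (\<lambda>i. u (pt \<tau> i)) i
    - (\<Sum>m = 1..n. ((pt \<tau> (Suc i) - Z \<tau> i) ^ m - (pt \<tau> i - Z \<tau> i) ^ m) / hhalf \<tau> i / fact m
        * nderiv m u (Z \<tau> i))\<bar> \<le> 2 * (C_norm (K + 2) u * \<bar>hhalf \<tau> i ^ n\<bar>)"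
    unfolding H_def M_def z_def .
qed simp

lemma mean_order_dquot_at_pt:
  assumes "n < K + 2"
  shows "mean_order n (\<lambda>u f \<tau> i. dquot \<tau> (\<lambda>i. u (pt \<tau> i)) i
    - (\<Sum>j = 1..n. hhalf \<tau> i ^ (j - 1) / fact j * nderiv j u (pt \<tau> i)))"
proof (rule mean_order_cong)
  show "mean_order n (\<lambda>u f \<tau> i. dquot \<tau> (\<lambda>i. u (pt \<tau> i)) i
    - (\<Sum>m = 1..n. ((pt \<tau> (Suc i) - pt \<tau> i) ^ m - (pt \<tau> i - pt \<tau> i) ^ m) / hhalf \<tau> i / fact m
        * nderiv m u (pt \<tau> i)))"
    by (rule mean_order_taylor_dquot[OF assms]) (use pt_mono in auto)
  fix u f \<tau> i assume *: "problem u f \<tau>" "i \<le> msize \<tau>"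
  have h: "hhalf \<tau> i \<noteq> 0" using hhalf_pos[OF problemD(3)[OF *(1)] *(2)] by simp
  have "hhalf \<tau> i ^ (m - 1) = ((pt \<tau> (Suc i) - pt \<tau> i) ^ m - (pt \<tau> i - pt \<tau> i) ^ m) / hhalf \<tau> i"
    if m: "m \<in> {1..n}" for m
  proof -
    obtain m' where "m = Suc m'" using m by (cases m) auto
    then show ?thesis using h by (simp add: hhalf_def)
  qed
  then show "dquot \<tau> (\<lambda>i. u (pt \<tau> i)) i
      - (\<Sum>j = 1..n. hhalf \<tau> i ^ (j - 1) / fact j * nderiv j u (pt \<tau> i))
    = dquot \<tau> (\<lambda>i. u (pt \<tau> i)) i
    - (\<Sum>m = 1..n. ((pt \<tau> (Suc i) - pt \<tau> i) ^ m - (pt \<tau> i - pt \<tau> i) ^ m) / hhalf \<tau> i / fact m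
        * nderiv m u (pt \<tau> i))"
    by (metis (no_types, lifting) sum.cong)
qed

lemma hhalf_mult_amesh:
  assumes "1 \<le> m"
  shows "hhalf \<tau> i * amesh \<tau> i m = (hminus \<tau> (Suc i) ^ m - (- hplus \<tau> i) ^ m) / fact m"
proof -
  obtain n where n: "m = Suc n" using assms by (cases m) auto
  have "{0..n} = {..<Suc n}" by auto
  then show ?thesis
    using diff_power_eq_sum[of "hminus \<tau> (Suc i)" n "- hplus \<tau> i"]
    unfolding n amesh_def hhalf_eq by (simp add: add.commute del: sum.lessThan_Suc power_Suc)
qed

text \<open>With centre $x_{i+1/2}$ the divided differences of powers are the coefficients $a^i_m$.\<close>

lemma mean_order_dquot_at_hpt:
  assumes "n < K + 2"
  shows "mean_order n (\<lambda>u f \<tau> i. dquot \<tau> (\<lambda>i. u (pt \<tau> i)) i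
    - (\<Sum>m = 1..n. amesh \<tau> i m * nderiv m u (hpt \<tau> i)))"
proof (rule mean_order_cong)
  show "mean_order n (\<lambda>u f \<tau> i. dquot \<tau> (\<lambda>i. u (pt \<tau> i)) i
    - (\<Sum>m = 1..n. ((pt \<tau> (Suc i) - hpt \<tau> i) ^ m - (pt \<tau> i - hpt \<tau> i) ^ m) / hhalf \<tau> i / fact m
        * nderiv m u (hpt \<tau> i)))"
    by (rule mean_order_taylor_dquot[OF assms]) (simp add: pt_le_hpt hpt_le_pt_Suc)
  fix u f \<tau> i assume *: "problem u f \<tau>" "i \<le> msize \<tau>"
  have h: "hhalf \<tau> i \<noteq> 0" using hhalf_pos[OF problemD(3)[OF *(1)] *(2)] by simp
  have "amesh \<tau> i m
      = ((pt \<tau> (Suc i) - hpt \<tau> i) ^ m - (pt \<tau> i - hpt \<tau> i) ^ m) / hhalf \<tau> i / fact m"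
    if "m \<in> {1..n}" for m
    using hhalf_mult_amesh[of m \<tau> i] that h
    by (simp add: field_simps hminus_def hplus_def)
  then show "dquot \<tau> (\<lambda>i. u (pt \<tau> i)) i
      - (\<Sum>m = 1..n. amesh \<tau> i m * nderiv m u (hpt \<tau> i))
    = dquot \<tau> (\<lambda>i. u (pt \<tau> i)) i
    - (\<Sum>m = 1..n. ((pt \<tau> (Suc i) - hpt \<tau> i) ^ m - (pt \<tau> i - hpt \<tau> i) ^ m) / hhalf \<tau> i / fact m
        * nderiv m u (hpt \<tau> i))"
    by (metis (no_types, lifting) sum.cong)
qed

section \<open>Consistency of a corrected scheme\<close>

text \<open>\<open>D\<close> is an array of approximate derivatives, given through its orders of accuracy. For
  \<open>l \<ge> 2\<close> the second hypothesis improves the first by one order. This is what the diffusion term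
  needs, because its coefficient $a^i_m$ is only of order $m-1$; in the convection and reaction
  terms the \<open>l\<close>th derivative carries at least \<open>l\<close> powers of the mesh lengths.\<close>

context
  fixes k :: nat and D :: "(real \<Rightarrow> real) \<Rightarrow> mesh \<Rightarrow> nat \<Rightarrow> nat \<Rightarrow> real"
  assumes k: "k \<le> K"
    and D1: "\<And>l. 1 \<le> l \<Longrightarrow> l \<le> k \<Longrightarrow>
      mean_order (k + 1 - l) (\<lambda>u f \<tau> i. D f \<tau> l i - nderiv l u (pt \<tau> i))"
    and D2: "\<And>l. 2 \<le> l \<Longrightarrow> l \<le> k + 1 \<Longrightarrow>
      mean_order (k + 2 - l) (\<lambda>u f \<tau> i. D f \<tau> l i - nderiv l u (pt \<tau> i))"
begin

lemma half_deriv_consistent: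
  assumes "2 \<le> m" "m \<le> k + 1"
  shows "mean_order (k + 2 - m)
    (\<lambda>u f \<tau> i. half_deriv \<tau> k (D f \<tau>) m i - nderiv m u (hpt \<tau> i))"
proof (rule mean_order_cong)
  have "mean_order (Suc (k + 1 - m)) (\<lambda>u f \<tau> i. nderiv m u (hpt \<tau> i)
    - (\<Sum>j\<le>k + 1 - m. (hpt \<tau> i - pt \<tau> i) ^ j / fact j * nderiv (m + j) u (pt \<tau> i)))"
    using assms k coeff_order_hplus pt_in_unit hpt_in_unit
    by (intro mean_order_taylor) (auto simp: hplus_def[abs_def])
  moreover have "Suc (k + 1 - m) = k + 2 - m" using assms by simp
  moreover have "mean_order (k + 2 - m) (\<lambda>u f \<tau> i. \<Sum>j\<le>k + 1 - m. hplus \<tau> i ^ j / fact j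
      * (D f \<tau> (m + j) i - nderiv (m + j) u (pt \<tau> i)))"
    using assms
    by (intro mean_order_sum mean_order_mult[OF
          coeff_order_divide[OF coeff_order_power[OF coeff_order_hplus]] D2]) auto
  ultimately show "mean_order (k + 2 - m) (\<lambda>u f \<tau> i. (\<Sum>j\<le>k + 1 - m. hplus \<tau> i ^ j / fact j
      * (D f \<tau> (m + j) i - nderiv (m + j) u (pt \<tau> i)))
    - (nderiv m u (hpt \<tau> i)
    - (\<Sum>j\<le>k + 1 - m. (hpt \<tau> i - pt \<tau> i) ^ j / fact j * nderiv (m + j) u (pt \<tau> i))))"
    by (auto intro: mean_order_diff)
qed (simp add: half_deriv_def hplus_def atMost_atLeast0 sum_subtractf algebra_simps
    diff_divide_distrib)

text \<open>A defect is an exact quantity minus the discrete quantity that represents it in the corrected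
  scheme. In each case the exact derivatives are inserted: what remains is a Taylor remainder and
  the errors of \<open>D\<close> with their coefficients.\<close>

definition diffusion_defect :: quantity where
  "diffusion_defect u f \<tau> i = dquot \<tau> (\<lambda>i. u (pt \<tau> i)) i - nderiv 1 u (hpt \<tau> i)
     - (\<Sum>m = 2..k + 1. amesh \<tau> i m * half_deriv \<tau> k (D f \<tau>) m i)"

lemma mean_order_diffusion_defect: "mean_order (k + 1) diffusion_defect"
proof (rule mean_order_cong)
  show "mean_order (k + 1) (\<lambda>u f \<tau> i. (dquot \<tau> (\<lambda>i. u (pt \<tau> i)) i
      - (\<Sum>m = 1..k + 1. amesh \<tau> i m * nderiv m u (hpt \<tau> i)))
    - (\<Sum>m = 2..k + 1. amesh \<tau> i m
        * (half_deriv \<tau> k (D f \<tau>) m i - nderiv m u (hpt \<tau> i))))"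
    using k by (intro mean_order_diff mean_order_dquot_at_hpt mean_order_sum
        mean_order_mult[OF coeff_order_amesh half_deriv_consistent]) auto
  fix u f \<tau> i
  have "(\<Sum>m = 1..k + 1. amesh \<tau> i m * nderiv m u (hpt \<tau> i))
      = nderiv 1 u (hpt \<tau> i) + (\<Sum>m = 2..k + 1. amesh \<tau> i m * nderiv m u (hpt \<tau> i))"
    by (subst sum.atLeast_Suc_atMost) (auto simp: amesh_def numeral_2_eq_2)
  then show "diffusion_defect u f \<tau> i = (dquot \<tau> (\<lambda>i. u (pt \<tau> i)) i
      - (\<Sum>m = 1..k + 1. amesh \<tau> i m * nderiv m u (hpt \<tau> i)))
    - (\<Sum>m = 2..k + 1. amesh \<tau> i m * (half_deriv \<tau> k (D f \<tau>) m i - nderiv m u (hpt \<tau> i)))"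
    by (simp add: diffusion_defect_def right_diff_distrib sum_subtractf)
qed

definition convection_defect :: quantity where
  "convection_defect u f \<tau> i = u (hpt \<tau> i) - u (pt \<tau> i)
     - (\<Sum>m = 1..k. hplus \<tau> i ^ m / fact m * D f \<tau> m i)"

lemma mean_order_convection_defect: "mean_order (k + 1) convection_defect"
proof (rule mean_order_cong)
  have "mean_order (Suc k) (\<lambda>u f \<tau> i. nderiv 0 u (hpt \<tau> i)
      - (\<Sum>j\<le>k. (hpt \<tau> i - pt \<tau> i) ^ j / fact j * nderiv (0 + j) u (pt \<tau> i)))"
    using k coeff_order_hplus pt_in_unit hpt_in_unit
    by (intro mean_order_taylor) (auto simp: hplus_def[abs_def])
  then show "mean_order (k + 1) (\<lambda>u f \<tau> i. (nderiv 0 u (hpt \<tau> i)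
      - (\<Sum>j\<le>k. (hpt \<tau> i - pt \<tau> i) ^ j / fact j * nderiv (0 + j) u (pt \<tau> i)))
    - (\<Sum>m = 1..k. hplus \<tau> i ^ m / fact m * (D f \<tau> m i - nderiv m u (pt \<tau> i))))"
    unfolding Suc_eq_plus1
    by (rule mean_order_diff) (intro mean_order_sum mean_order_mult[OF
          coeff_order_divide[OF coeff_order_power[OF coeff_order_hplus]] D1]; auto)
  fix u f \<tau> i
  have "(\<Sum>j\<le>k. (hpt \<tau> i - pt \<tau> i) ^ j / fact j * nderiv (0 + j) u (pt \<tau> i))
      = u (pt \<tau> i) + (\<Sum>j = 1..k. hplus \<tau> i ^ j / fact j * nderiv j u (pt \<tau> i))"
    unfolding atMost_atLeast0 by (subst sum.atLeast_Suc_atMost) (auto simp: hplus_def)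
  then show "convection_defect u f \<tau> i = (nderiv 0 u (hpt \<tau> i)
      - (\<Sum>j\<le>k. (hpt \<tau> i - pt \<tau> i) ^ j / fact j * nderiv (0 + j) u (pt \<tau> i)))
    - (\<Sum>m = 1..k. hplus \<tau> i ^ m / fact m * (D f \<tau> m i - nderiv m u (pt \<tau> i)))"
    by (simp add: convection_defect_def right_diff_distrib sum_subtractf)
qed

text \<open>The integral of \<open>u\<close> over a cell is split at the mesh point inside it. The right half uses
  derivatives at that point.\<close>

definition right_reaction_defect :: quantity where
  "right_reaction_defect u f \<tau> i =
     antideriv u (hpt \<tau> i) - antideriv u (pt \<tau> i) - hplus \<tau> i * u (pt \<tau> i)
     - (\<Sum>m = 1..k. hplus \<tau> i ^ (m + 1) / fact (m + 1) * D f \<tau> m i)"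

lemma mean_order_right_reaction_defect:
  "mean_order (k + 1) (\<lambda>u f \<tau> i. right_reaction_defect u f \<tau> i / hhalf \<tau> i)"
proof (rule mean_order_cong)
  have le: "\<bar>hplus \<tau> i\<bar> \<le> hhalf \<tau> i" if "admissible \<tau>" "i \<le> msize \<tau>" for \<tau> i
    using hplus_bounds[OF that] hminus_bounds[OF that] by (simp add: hhalf_eq)
  have "mean_order (k + 1) (\<lambda>u f \<tau> i. (antideriv u (hpt \<tau> i) - antideriv u (pt \<tau> i)
    - (\<Sum>j\<le>k. (hpt \<tau> i - pt \<tau> i) ^ Suc j / fact (Suc j) * nderiv j u (pt \<tau> i))) / hhalf \<tau> i)"
    using k coeff_order_hplus pt_in_unit hpt_in_unit le
    by (intro mean_order_taylor_antideriv) (auto simp: hplus_def[abs_def])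
  then show "mean_order (k + 1) (\<lambda>u f \<tau> i. (antideriv u (hpt \<tau> i) - antideriv u (pt \<tau> i)
    - (\<Sum>j\<le>k. (hpt \<tau> i - pt \<tau> i) ^ Suc j / fact (Suc j) * nderiv j u (pt \<tau> i))) / hhalf \<tau> i
    - (\<Sum>m = 1..k. hplus \<tau> i ^ (m + 1) / hhalf \<tau> i / fact (m + 1)
        * (D f \<tau> m i - nderiv m u (pt \<tau> i))))"
    by (intro mean_order_diff mean_order_sum mean_order_mult[OF
          coeff_order_divide[OF coeff_order_power_div_hhalf[OF coeff_order_hplus le]] D1]) auto
  fix u f \<tau> i
  have "(\<Sum>j\<le>k. (hpt \<tau> i - pt \<tau> i) ^ Suc j / fact (Suc j) * nderiv j u (pt \<tau> i))
      = hplus \<tau> i * u (pt \<tau> i)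
        + (\<Sum>j = 1..k. hplus \<tau> i ^ (j + 1) / fact (j + 1) * nderiv j u (pt \<tau> i))"
    unfolding atMost_atLeast0 by (subst sum.atLeast_Suc_atMost) (auto simp: hplus_def)
  then show "right_reaction_defect u f \<tau> i / hhalf \<tau> i
    = (antideriv u (hpt \<tau> i) - antideriv u (pt \<tau> i)
    - (\<Sum>j\<le>k. (hpt \<tau> i - pt \<tau> i) ^ Suc j / fact (Suc j) * nderiv j u (pt \<tau> i))) / hhalf \<tau> i
    - (\<Sum>m = 1..k. hplus \<tau> i ^ (m + 1) / hhalf \<tau> i / fact (m + 1)
        * (D f \<tau> m i - nderiv m u (pt \<tau> i)))"
    by (simp add: right_reaction_defect_def right_diff_distrib sum_subtractf diff_divide_distrib
        sum_divide_distrib add_divide_distrib mult_ac)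
qed

text \<open>The left half belongs to the cell of $x_{i+1}$ but uses derivatives extrapolated from $x_i$; with
  this indexing all data come from the interval of length $h_{i+1/2}$, so this length can serve as
  the weight.\<close>

definition left_reaction_defect :: quantity where
  "left_reaction_defect u f \<tau> i =
     antideriv u (pt \<tau> (Suc i)) - antideriv u (hpt \<tau> i) - hminus \<tau> (Suc i) * u (pt \<tau> (Suc i))
     + (\<Sum>m = 1..k. (- hminus \<tau> (Suc i)) ^ (m + 1) / fact (m + 1)
         * (\<Sum>j = 0..k - m. hhalf \<tau> i ^ j / fact j * D f \<tau> (m + j) i))"

lemma extrapolated_deriv_consistent:
  assumes "1 \<le> m" "m \<le> k"
  shows "mean_order (k + 1 - m) (\<lambda>u f \<tau> i.
    (\<Sum>j = 0..k - m. hhalf \<tau> i ^ j / fact j * D f \<tau> (m + j) i) - nderiv m u (pt \<tau> (Suc i)))"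
proof (rule mean_order_cong)
  have "mean_order (Suc (k - m)) (\<lambda>u f \<tau> i. nderiv m u (pt \<tau> (Suc i))
    - (\<Sum>j\<le>k - m. (pt \<tau> (Suc i) - pt \<tau> i) ^ j / fact j * nderiv (m + j) u (pt \<tau> i)))"
    using assms k coeff_order_hhalf pt_in_unit
    by (intro mean_order_taylor) (auto simp: hhalf_def[abs_def])
  moreover have "Suc (k - m) = k + 1 - m" using assms by simp
  moreover have "mean_order (k + 1 - m) (\<lambda>u f \<tau> i. \<Sum>j\<le>k - m. hhalf \<tau> i ^ j / fact j
      * (D f \<tau> (m + j) i - nderiv (m + j) u (pt \<tau> i)))"
    using assms
    by (intro mean_order_sum mean_order_mult[OF
          coeff_order_divide[OF coeff_order_power[OF coeff_order_hhalf]] D1]) auto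
  ultimately show "mean_order (k + 1 - m) (\<lambda>u f \<tau> i. (\<Sum>j\<le>k - m. hhalf \<tau> i ^ j / fact j
      * (D f \<tau> (m + j) i - nderiv (m + j) u (pt \<tau> i)))
    - (nderiv m u (pt \<tau> (Suc i))
    - (\<Sum>j\<le>k - m. (pt \<tau> (Suc i) - pt \<tau> i) ^ j / fact j * nderiv (m + j) u (pt \<tau> i))))"
    by (auto intro: mean_order_diff)
qed (simp add: hhalf_def atMost_atLeast0 sum_subtractf algebra_simps diff_divide_distrib)

lemma mean_order_left_reaction_defect:
  "mean_order (k + 1) (\<lambda>u f \<tau> i. left_reaction_defect u f \<tau> i / hhalf \<tau> i)"
proof (rule mean_order_cong)
  let ?Q = "\<lambda>\<tau> i. - hminus \<tau> (Suc i)"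
  let ?E = "\<lambda>m u f \<tau> i. (\<Sum>j = 0..k - m. hhalf \<tau> i ^ j / fact j * D f \<tau> (m + j) i)
    - nderiv m u (pt \<tau> (Suc i))"
  have Q: "coeff_order 1 ?Q"
    using coeff_order_uminus[OF coeff_order_hminus] .
  have eq: "hpt \<tau> i - pt \<tau> (Suc i) = ?Q \<tau> i" for \<tau> i by (simp add: hminus_def)
  have le: "\<bar>?Q \<tau> i\<bar> \<le> hhalf \<tau> i" if "admissible \<tau>" "i \<le> msize \<tau>" for \<tau> i
    using hplus_bounds[OF that] hminus_bounds[OF that] by (simp add: hhalf_eq)
  have "mean_order (k + 1) (\<lambda>u f \<tau> i. (antideriv u (hpt \<tau> i) - antideriv u (pt \<tau> (Suc i))
    - (\<Sum>j\<le>k. (hpt \<tau> i - pt \<tau> (Suc i)) ^ Suc j / fact (Suc j) * nderiv j u (pt \<tau> (Suc i))))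
      / hhalf \<tau> i)"
    using k Q pt_in_unit hpt_in_unit le
    by (intro mean_order_taylor_antideriv) (auto simp: eq)
  then show "mean_order (k + 1) (\<lambda>u f \<tau> i.
    (\<Sum>m = 1..k. ?Q \<tau> i ^ (m + 1) / hhalf \<tau> i / fact (m + 1) * ?E m u f \<tau> i)
    - (antideriv u (hpt \<tau> i) - antideriv u (pt \<tau> (Suc i))
    - (\<Sum>j\<le>k. (hpt \<tau> i - pt \<tau> (Suc i)) ^ Suc j / fact (Suc j) * nderiv j u (pt \<tau> (Suc i))))
      / hhalf \<tau> i)"
    by (intro mean_order_diff mean_order_sum mean_order_mult[OF
          coeff_order_divide[OF coeff_order_power_div_hhalf[OF Q le]]
          extrapolated_deriv_consistent]) auto
  fix u f \<tau> i
  have "(\<Sum>j\<le>k. (hpt \<tau> i - pt \<tau> (Suc i)) ^ Suc j / fact (Suc j) * nderiv j u (pt \<tau> (Suc i)))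
      = ?Q \<tau> i * u (pt \<tau> (Suc i))
        + (\<Sum>j = 1..k. ?Q \<tau> i ^ (j + 1) / fact (j + 1) * nderiv j u (pt \<tau> (Suc i)))"
    unfolding atMost_atLeast0 by (subst sum.atLeast_Suc_atMost) (auto simp: eq)
  moreover have "(\<Sum>m = 1..k. ?Q \<tau> i ^ (m + 1) / hhalf \<tau> i / fact (m + 1) * ?E m u f \<tau> i)
      = ((\<Sum>m = 1..k. ?Q \<tau> i ^ (m + 1) / fact (m + 1)
          * (\<Sum>j = 0..k - m. hhalf \<tau> i ^ j / fact j * D f \<tau> (m + j) i))
        - (\<Sum>m = 1..k. ?Q \<tau> i ^ (m + 1) / fact (m + 1) * nderiv m u (pt \<tau> (Suc i))))
        / hhalf \<tau> i"
    unfolding sum_subtractf[symmetric] sum_divide_distrib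
    by (intro sum.cong refl) (simp add: right_diff_distrib diff_divide_distrib mult_ac)
  ultimately show "left_reaction_defect u f \<tau> i / hhalf \<tau> i =
    (\<Sum>m = 1..k. ?Q \<tau> i ^ (m + 1) / hhalf \<tau> i / fact (m + 1) * ?E m u f \<tau> i)
    - (antideriv u (hpt \<tau> i) - antideriv u (pt \<tau> (Suc i))
    - (\<Sum>j\<le>k. (hpt \<tau> i - pt \<tau> (Suc i)) ^ Suc j / fact (Suc j) * nderiv j u (pt \<tau> (Suc i))))
      / hhalf \<tau> i"
    by (simp add: left_reaction_defect_def diff_divide_distrib add_divide_distrib)
qed

definition flux_defect :: quantity where
  "flux_defect u f \<tau> i = diffusion_defect u f \<tau> i + \<alpha> * convection_defect u f \<tau> i"

text \<open>The flux corrections at the two ends of a cell are the same quantity at consecutive indices, so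
  they form a difference, which is the shape that \<open>fv_stability\<close> handles.\<close>

lemma error_equation:
  assumes "problem u f \<tau>" "i \<in> {1..msize \<tau>}"
    and "fv_op \<alpha> \<beta> \<tau> v i = corr_rhs \<alpha> \<beta> f \<tau> k (D f \<tau>) i"
  shows "fv_op \<alpha> \<beta> \<tau> (\<lambda>i. v i - u (pt \<tau> i)) i =
    flux_defect u f \<tau> i - flux_defect u f \<tau> (i - 1)
    + \<beta> * (right_reaction_defect u f \<tau> i + left_reaction_defect u f \<tau> (i - 1))"
proof -
  note p = problemD[OF assms(1)]
  obtain j where j: "i = Suc j" using assms(2) by (cases i) auto
  have "hpt \<tau> j \<le> hpt \<tau> i" "hpt \<tau> j \<in> {0..1}" "hpt \<tau> i \<in> {0..1}"
    using hcell_pos[OF p(3) assms(2)] hpt_in_unit[OF p(3)] assms(2)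
    by (auto simp: hcell_def j)
  then have rhs: "fv_rhs f \<tau> i
    = (- nderiv 1 u (hpt \<tau> i) + \<alpha> * u (hpt \<tau> i) + \<beta> * antideriv u (hpt \<tau> i))
    - (- nderiv 1 u (hpt \<tau> j) + \<alpha> * u (hpt \<tau> j) + \<beta> * antideriv u (hpt \<tau> j))"
    using integral_rhs[OF p(1,2), of "hpt \<tau> j" "hpt \<tau> i"] by (simp add: fv_rhs_def j)
  have "dquot \<tau> (\<lambda>i. v i - u (pt \<tau> i)) n = dquot \<tau> v n - dquot \<tau> (\<lambda>i. u (pt \<tau> i)) n" for n
    by (simp add: dquot_def diff_divide_distrib)
  then have "fv_op \<alpha> \<beta> \<tau> (\<lambda>i. v i - u (pt \<tau> i)) i
    = fv_op \<alpha> \<beta> \<tau> v i - fv_op \<alpha> \<beta> \<tau> (\<lambda>i. u (pt \<tau> i)) i"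
    by (simp add: fv_op_def algebra_simps)
  also have "\<dots> = flux_defect u f \<tau> i - flux_defect u f \<tau> j
    + \<beta> * (right_reaction_defect u f \<tau> i + left_reaction_defect u f \<tau> j)"
  proof -
    define d where "d = dquot \<tau> (\<lambda>i. u (pt \<tau> i))"
    define A where "A n = (\<Sum>m = 2..k + 1. amesh \<tau> n m * half_deriv \<tau> k (D f \<tau>) m n)" for n
    define B where "B n = (\<Sum>m = 1..k. hplus \<tau> n ^ m / fact m * D f \<tau> m n)" for n
    define R where "R n = (\<Sum>m = 1..k. hplus \<tau> n ^ (m + 1) / fact (m + 1) * D f \<tau> m n)" for n
    define L where "L n = (\<Sum>m = 1..k. (- hminus \<tau> (Suc n)) ^ (m + 1) / fact (m + 1)
         * (\<Sum>j = 0..k - m. hhalf \<tau> n ^ j / fact j * D f \<tau> (m + j) n))" for n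
    have flux: "flux_defect u f \<tau> n = d n - nderiv 1 u (hpt \<tau> n) - A n
        + \<alpha> * (u (hpt \<tau> n) - u (pt \<tau> n) - B n)" for n
      by (simp add: flux_defect_def diffusion_defect_def convection_defect_def A_def B_def d_def)
    have right: "right_reaction_defect u f \<tau> i
        = antideriv u (hpt \<tau> i) - antideriv u (pt \<tau> i) - hplus \<tau> i * u (pt \<tau> i) - R i"
      by (simp add: right_reaction_defect_def R_def)
    have left: "left_reaction_defect u f \<tau> j
        = antideriv u (pt \<tau> i) - antideriv u (hpt \<tau> j) - hminus \<tau> i * u (pt \<tau> i) + L j"
      by (simp add: left_reaction_defect_def L_def j)
    have "corr_rhs \<alpha> \<beta> f \<tau> k (D f \<tau>) i
        = fv_rhs f \<tau> i - A i + A j - \<alpha> * B i + \<alpha> * B j - \<beta> * (R i - L j)"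
      unfolding corr_rhs_def A_def B_def R_def L_def j diff_Suc_1 ..
    moreover have "fv_op \<alpha> \<beta> \<tau> (\<lambda>i. u (pt \<tau> i)) i = - d i + d j + \<alpha> * (u (pt \<tau> i) - u (pt \<tau> j))
        + \<beta> * (hplus \<tau> i + hminus \<tau> i) * u (pt \<tau> i)"
      by (simp add: fv_op_def d_def hcell_eq j)
    ultimately show ?thesis
      unfolding assms(3) rhs flux right left by (simp add: algebra_simps)
  qed
  finally show ?thesis by (simp add: j)
qed

lemma sum_abs_le_wnorm_quotient:
  assumes "admissible \<tau>"
  shows "(\<Sum>i = 0..msize \<tau>. \<bar>g i\<bar>) \<le> wnorm \<tau> (\<lambda>i. g i / hhalf \<tau> i)"
proof -
  have "(\<Sum>i = 0..msize \<tau>. \<bar>g i\<bar>) = (\<Sum>i = 0..msize \<tau>. hhalf \<tau> i * \<bar>g i / hhalf \<tau> i\<bar>)"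
  proof (rule sum.cong[OF refl])
    fix i assume "i \<in> {0..msize \<tau>}"
    then have "0 < hhalf \<tau> i" using hhalf_pos[OF assms] by simp
    then show "\<bar>g i\<bar> = hhalf \<tau> i * \<bar>g i / hhalf \<tau> i\<bar>" by (simp add: abs_divide)
  qed
  also have "\<dots> \<le> wnorm \<tau> (\<lambda>i. g i / hhalf \<tau> i)"
    by (rule weighted_sum_le_wnorm[OF assms])
  finally show ?thesis .
qed

lemma error_mean_order:
  assumes "\<And>u f \<tau>. problem u f \<tau> \<Longrightarrow>
    fv_solution \<alpha> \<beta> \<tau> (corr_rhs \<alpha> \<beta> f \<tau> k (D f \<tau>)) (v f \<tau>)"
  shows "mean_order (k + 1) (\<lambda>u f \<tau>. dquot \<tau> (\<lambda>i. v f \<tau> i - u (pt \<tau> i)))"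
proof -
  have "mean_order (k + 1) flux_defect"
    unfolding flux_defect_def[abs_def]
    by (intro mean_order_add mean_order_scale mean_order_convection_defect
        mean_order_diffusion_defect)
  then obtain A where A: "0 \<le> A" "\<And>u f \<tau>. problem u f \<tau> \<Longrightarrow>
      wnorm \<tau> (flux_defect u f \<tau>) \<le> A * (meshsize \<tau> ^ (k + 1) * C_norm (K + 2) u)"
    by (rule mean_orderE) blast
  from mean_order_right_reaction_defect obtain B where B: "0 \<le> B"
    "\<And>u f \<tau>. problem u f \<tau> \<Longrightarrow> wnorm \<tau> (\<lambda>i. right_reaction_defect u f \<tau> i / hhalf \<tau> i)
      \<le> B * (meshsize \<tau> ^ (k + 1) * C_norm (K + 2) u)"
    by (rule mean_orderE) blast
  from mean_order_left_reaction_defect obtain C where C: "0 \<le> C"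
    "\<And>u f \<tau>. problem u f \<tau> \<Longrightarrow> wnorm \<tau> (\<lambda>i. left_reaction_defect u f \<tau> i / hhalf \<tau> i)
      \<le> C * (meshsize \<tau> ^ (k + 1) * C_norm (K + 2) u)"
    by (rule mean_orderE) blast
  show ?thesis
  proof (rule mean_orderI[of "A + \<beta> * (B + C)"])
    fix u f \<tau> assume *: "problem u f \<tau>"
    note p = problemD[OF *]
    define M where "M = meshsize \<tau> ^ (k + 1) * C_norm (K + 2) u"
    define N where "N = msize \<tau>"
    let ?R = "right_reaction_defect u f \<tau>" and ?L = "left_reaction_defect u f \<tau>"
    have sol: "v f \<tau> 0 = 0" "v f \<tau> (Suc N) = 0"
      "\<And>i. i \<in> {1..N} \<Longrightarrow> fv_op \<alpha> \<beta> \<tau> (v f \<tau>) i = corr_rhs \<alpha> \<beta> f \<tau> k (D f \<tau>) i"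
      using assms[OF *] by (auto simp: fv_solution_def N_def)
    have bc: "u (pt \<tau> 0) = 0" "u (pt \<tau> (Suc N)) = 0"
      using p(1) admissible_end_points[OF p(3)] by (auto simp: solves_bvp_def N_def)
    have "wnorm \<tau> (dquot \<tau> (\<lambda>i. v f \<tau> i - u (pt \<tau> i)))
        \<le> wnorm \<tau> (flux_defect u f \<tau>) + (\<Sum>i = 1..msize \<tau>. \<bar>\<beta> * (?R i + ?L (i - 1))\<bar>)"
      using sol bc
      by (intro fv_stability[OF \<alpha>_nonneg \<beta>_nonneg p(3)] error_equation[OF *])
        (auto simp: N_def)
    moreover have "(\<Sum>i = 1..N. \<bar>\<beta> * (?R i + ?L (i - 1))\<bar>) \<le> \<beta> * (B * M + C * M)"
    proof -
      have "(\<Sum>i = 1..N. \<bar>?R i + ?L (i - 1)\<bar>) \<le> (\<Sum>i = 1..N. \<bar>?R i\<bar>) + (\<Sum>i = 1..N. \<bar>?L (i - 1)\<bar>)"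
        unfolding sum.distrib[symmetric] by (intro sum_mono abs_triangle_ineq)
      moreover have "(\<Sum>i = 1..N. \<bar>?R i\<bar>) \<le> (\<Sum>i = 0..N. \<bar>?R i\<bar>)"
        by (intro sum_mono2) auto
      moreover have "(\<Sum>i = 1..N. \<bar>?L (i - 1)\<bar>) = (\<Sum>i<N. \<bar>?L i\<bar>)"
        using sum.atLeast1_atMost_eq[of "\<lambda>i. \<bar>?L (i - 1)\<bar>" N] by simp
      moreover have "(\<Sum>i<N. \<bar>?L i\<bar>) \<le> (\<Sum>i = 0..N. \<bar>?L i\<bar>)"
        by (intro sum_mono2) auto
      moreover have "(\<Sum>i = 0..N. \<bar>?R i\<bar>) \<le> B * M" "(\<Sum>i = 0..N. \<bar>?L i\<bar>) \<le> C * M"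
        using sum_abs_le_wnorm_quotient[OF p(3), of ?R] B(2)[OF *]
          sum_abs_le_wnorm_quotient[OF p(3), of ?L] C(2)[OF *]
        by (simp_all add: N_def M_def)
      ultimately have "(\<Sum>i = 1..N. \<bar>?R i + ?L (i - 1)\<bar>) \<le> B * M + C * M" by linarith
      then show ?thesis
        using \<beta>_nonneg
        by (simp add: abs_mult sum_distrib_left[symmetric] mult_left_mono)
    qed
    ultimately show "wnorm \<tau> (dquot \<tau> (\<lambda>i. v f \<tau> i - u (pt \<tau> i)))
        \<le> (A + \<beta> * (B + C)) * (meshsize \<tau> ^ (k + 1) * C_norm (K + 2) u)"
      using A(2)[OF *] unfolding M_def[symmetric] N_def[symmetric] by (simp add: algebra_simps)
  qed (use A B C \<beta>_nonneg in simp)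
qed

end

section \<open>Propagation of errors through the approximate derivatives\<close>

text \<open>The formula for the highest derivative is the general one with an empty sum.\<close>

lemma approx_derivs_high_eq:
  assumes "l \<le> k + 1"
  shows "approx_derivs_high \<alpha> \<beta> f \<tau> k v E l i =
    (\<Sum>j = 0..l - 2. co \<alpha> \<beta> l j * nderiv j f (pt \<tau> i)) + co1 \<alpha> \<beta> l * v i
    + co2 \<alpha> \<beta> l * (dquot \<tau> v i
        - (\<Sum>j = 2..k + 2 - l. hhalf \<tau> i ^ (j - 1) / fact j * E j i))"
  by (auto simp: approx_derivs_high_def mult_ac)

text \<open>\<open>v\<close> and \<open>E\<close> stand for the correction of level \<open>k - 1\<close> and its array of approximate
  derivatives.\<close>

context
  fixes k :: nat and v :: "(real \<Rightarrow> real) \<Rightarrow> mesh \<Rightarrow> nat \<Rightarrow> real"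
    and E :: "(real \<Rightarrow> real) \<Rightarrow> mesh \<Rightarrow> nat \<Rightarrow> nat \<Rightarrow> real"
  assumes k: "k \<le> K"
    and v0: "\<And>u f \<tau>. problem u f \<tau> \<Longrightarrow> v f \<tau> 0 = 0"
    and v: "mean_order k (\<lambda>u f \<tau>. dquot \<tau> (\<lambda>i. v f \<tau> i - u (pt \<tau> i)))"
    and E: "\<And>l. 2 \<le> l \<Longrightarrow> l \<le> k \<Longrightarrow>
      mean_order (k + 1 - l) (\<lambda>u f \<tau> i. E f \<tau> l i - nderiv l u (pt \<tau> i))"
begin

lemma mean_order_values: "mean_order k (\<lambda>u f \<tau> i. v f \<tau> i - u (pt \<tau> i))"
proof -
  from v obtain A where A: "0 \<le> A" "\<And>u f \<tau>. problem u f \<tau> \<Longrightarrow>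
      wnorm \<tau> (dquot \<tau> (\<lambda>i. v f \<tau> i - u (pt \<tau> i))) \<le> A * (meshsize \<tau> ^ k * C_norm (K + 2) u)"
    by (rule mean_orderE) blast
  show ?thesis
  proof (rule mean_order_max[OF A(1)])
    fix u f \<tau> i assume *: "problem u f \<tau>" "i \<le> msize \<tau>"
    note p = problemD[OF *(1)]
    have "u (pt \<tau> 0) = 0"
      using p(1) admissible_end_points[OF p(3)] by (simp add: solves_bvp_def)
    then have "\<bar>v f \<tau> i - u (pt \<tau> i)\<bar> \<le> wnorm \<tau> (dquot \<tau> (\<lambda>i. v f \<tau> i - u (pt \<tau> i)))"
      using v0[OF *(1)] *(2) by (intro discrete_Poincare[OF p(3)]) auto
    then show "\<bar>v f \<tau> i - u (pt \<tau> i)\<bar> \<le> A * (meshsize \<tau> ^ k * C_norm (K + 2) u)"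
      using A(2)[OF *(1)] by linarith
  qed
qed

text \<open>A difference quotient from which the higher terms of its Taylor expansion have been subtracted
  approximates $u_x(x_i)$. The approximations \<open>W\<close> of these terms may lose one order per derivative,
  because the factor $h_{i+1/2}^{j-1}$ restores it. The previous level supplies \<open>W\<close> when the
  derivatives of order at least two are computed, and the present level when $u_x$ is.\<close>

lemma mean_order_first_derivative:
  assumes "1 \<le> n" "n \<le> k"
    and W: "\<And>j. 2 \<le> j \<Longrightarrow> j \<le> n \<Longrightarrow>
      mean_order (n + 1 - j) (\<lambda>u f \<tau> i. W f \<tau> j i - nderiv j u (pt \<tau> i))"
  shows "mean_order n (\<lambda>u f \<tau> i. dquot \<tau> (v f \<tau>) i
    - (\<Sum>j = 2..n. hhalf \<tau> i ^ (j - 1) / fact j * W f \<tau> j i) - nderiv 1 u (pt \<tau> i))"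
proof (rule mean_order_cong)
  have "mean_order n (\<lambda>u f \<tau> i. \<Sum>j = 2..n. hhalf \<tau> i ^ (j - 1) / fact j
      * (W f \<tau> j i - nderiv j u (pt \<tau> i)))"
    by (intro mean_order_sum mean_order_mult[OF
          coeff_order_divide[OF coeff_order_power[OF coeff_order_hhalf]] W]) auto
  then show "mean_order n (\<lambda>u f \<tau> i. dquot \<tau> (\<lambda>i. v f \<tau> i - u (pt \<tau> i)) i
    + (dquot \<tau> (\<lambda>i. u (pt \<tau> i)) i
      - (\<Sum>j = 1..n. hhalf \<tau> i ^ (j - 1) / fact j * nderiv j u (pt \<tau> i)))
    - (\<Sum>j = 2..n. hhalf \<tau> i ^ (j - 1) / fact j * (W f \<tau> j i - nderiv j u (pt \<tau> i))))"
    using assms(2) k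
    by (intro mean_order_diff[OF mean_order_add] mean_order_dquot_at_pt mean_order_weaken[OF v]) auto
  fix u f \<tau> i
  have "(\<Sum>j = 1..n. hhalf \<tau> i ^ (j - 1) / fact j * nderiv j u (pt \<tau> i))
      = nderiv 1 u (pt \<tau> i) + (\<Sum>j = 2..n. hhalf \<tau> i ^ (j - 1) / fact j * nderiv j u (pt \<tau> i))"
    using assms(1) by (subst sum.atLeast_Suc_atMost) (auto simp: numeral_2_eq_2)
  then show "dquot \<tau> (v f \<tau>) i
    - (\<Sum>j = 2..n. hhalf \<tau> i ^ (j - 1) / fact j * W f \<tau> j i) - nderiv 1 u (pt \<tau> i)
    = dquot \<tau> (\<lambda>i. v f \<tau> i - u (pt \<tau> i)) i
    + (dquot \<tau> (\<lambda>i. u (pt \<tau> i)) i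
      - (\<Sum>j = 1..n. hhalf \<tau> i ^ (j - 1) / fact j * nderiv j u (pt \<tau> i)))
    - (\<Sum>j = 2..n. hhalf \<tau> i ^ (j - 1) / fact j * (W f \<tau> j i - nderiv j u (pt \<tau> i)))"
    by (simp add: dquot_def diff_divide_distrib right_diff_distrib sum_subtractf)
qed

text \<open>Compare the definition with the expansion of the exact derivative: the derivatives of \<open>f\<close> cancel,
  and the errors of \<open>u\<close> and of $u_x$ remain.\<close>

lemma approx_derivs_high_mean_order:
  assumes "2 \<le> l" "l \<le> k + 1"
  shows "mean_order (k + 2 - l) (\<lambda>u f \<tau> i.
    approx_derivs_high \<alpha> \<beta> f \<tau> k (v f \<tau>) (E f \<tau>) l i - nderiv l u (pt \<tau> i))"
proof (rule mean_order_cong)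
  have "mean_order (k + 2 - l) (\<lambda>u f \<tau> i. dquot \<tau> (v f \<tau>) i
    - (\<Sum>j = 2..k + 2 - l. hhalf \<tau> i ^ (j - 1) / fact j * E f \<tau> j i) - nderiv 1 u (pt \<tau> i))"
    using assms
    by (intro mean_order_first_derivative mean_order_weaken[OF E]) auto
  then show "mean_order (k + 2 - l) (\<lambda>u f \<tau> i. co1 \<alpha> \<beta> l * (v f \<tau> i - u (pt \<tau> i))
    + co2 \<alpha> \<beta> l * (dquot \<tau> (v f \<tau>) i
    - (\<Sum>j = 2..k + 2 - l. hhalf \<tau> i ^ (j - 1) / fact j * E f \<tau> j i) - nderiv 1 u (pt \<tau> i)))"
    using assms
    by (intro mean_order_add mean_order_scale mean_order_weaken[OF mean_order_values]) auto
  fix u f \<tau> i assume *: "problem u f \<tau>" "i \<le> msize \<tau>"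
  have "nderiv l u (pt \<tau> i) = (\<Sum>j = 0..l - 2. co \<alpha> \<beta> l j * nderiv j f (pt \<tau> i))
      + co1 \<alpha> \<beta> l * u (pt \<tau> i) + co2 \<alpha> \<beta> l * nderiv 1 u (pt \<tau> i)"
    using assms k pt_unit[OF *]
    by (intro nderiv_expansion[OF problemD(1,2)[OF *(1)]]) auto
  then show "approx_derivs_high \<alpha> \<beta> f \<tau> k (v f \<tau>) (E f \<tau>) l i - nderiv l u (pt \<tau> i)
    = co1 \<alpha> \<beta> l * (v f \<tau> i - u (pt \<tau> i)) + co2 \<alpha> \<beta> l * (dquot \<tau> (v f \<tau>) i
    - (\<Sum>j = 2..k + 2 - l. hhalf \<tau> i ^ (j - 1) / fact j * E f \<tau> j i) - nderiv 1 u (pt \<tau> i))"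
    unfolding approx_derivs_high_eq[OF assms(2)] by (simp add: algebra_simps)
qed

lemma approx_derivs_mean_order:
  assumes "1 \<le> l" "l \<le> k"
  shows "mean_order (k + 1 - l) (\<lambda>u f \<tau> i.
    approx_derivs \<alpha> \<beta> f \<tau> k (v f \<tau>) (E f \<tau>) l i - nderiv l u (pt \<tau> i))"
proof (cases "l = 1")
  case True
  have "mean_order k (\<lambda>u f \<tau> i. dquot \<tau> (v f \<tau>) i - (\<Sum>j = 2..k. hhalf \<tau> i ^ (j - 1) / fact j
    * approx_derivs_high \<alpha> \<beta> f \<tau> k (v f \<tau>) (E f \<tau>) j i) - nderiv 1 u (pt \<tau> i))"
    using assms
    by (intro mean_order_first_derivative mean_order_weaken[OF approx_derivs_high_mean_order]) auto
  then show ?thesis using True by (simp add: approx_derivs_def)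
next
  case False
  then show ?thesis
    using assms mean_order_weaken[OF approx_derivs_high_mean_order, of l "k + 1 - l"]
    by (simp add: approx_derivs_def)
qed

end

section \<open>Induction on the level of the correction\<close>

lemma fv_solve_solution: "admissible \<tau> \<Longrightarrow> fv_solution \<alpha> \<beta> \<tau> g (fv_solve \<alpha> \<beta> \<tau> g)"
  unfolding fv_solve_def by (rule theI'[OF fv_solution_ex1[OF \<alpha>_nonneg \<beta>_nonneg]])

text \<open>At level zero the second claim is empty, and the basic scheme is a corrected scheme all of whose
  sums are empty, so that any array serves as \<open>D\<close>.\<close>

lemma correction_mean_order:
  assumes "k \<le> K"
  shows "mean_order (k + 1) (\<lambda>u f \<tau>. dquot \<tau> (\<lambda>i. correction \<alpha> \<beta> f \<tau> k i - u (pt \<tau> i))) \<and>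
    (\<forall>l. 2 \<le> l \<and> l \<le> k + 1 \<longrightarrow> mean_order (k + 2 - l)
      (\<lambda>u f \<tau> i. snd (fv_level \<alpha> \<beta> f \<tau> k) l i - nderiv l u (pt \<tau> i)))"
  using assms
proof (induction k)
  case 0
  have "corr_rhs \<alpha> \<beta> f \<tau> 0 (\<lambda>l i. 0) = fv_rhs f \<tau>" for f \<tau>
    by (simp add: corr_rhs_def fun_eq_iff)
  then have "mean_order (0 + 1)
      (\<lambda>u f \<tau>. dquot \<tau> (\<lambda>i. correction \<alpha> \<beta> f \<tau> 0 i - u (pt \<tau> i)))"
    by (intro error_mean_order[where D = "\<lambda>f \<tau> l i. 0"])
      (auto simp: correction_def problem_def fv_solve_solution)
  then show ?case by auto
next
  case (Suc k)
  define v E where "v = (\<lambda>f \<tau>. correction \<alpha> \<beta> f \<tau> k)"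
    and "E = (\<lambda>f \<tau>. snd (fv_level \<alpha> \<beta> f \<tau> k))"
  define D where "D f \<tau> = approx_derivs \<alpha> \<beta> f \<tau> (Suc k) (v f \<tau>) (E f \<tau>)" for f \<tau>
  have level: "snd (fv_level \<alpha> \<beta> f \<tau> (Suc k)) = D f \<tau>"
    "correction \<alpha> \<beta> f \<tau> (Suc k) = fv_solve \<alpha> \<beta> \<tau> (corr_rhs \<alpha> \<beta> f \<tau> (Suc k) (D f \<tau>))" for f \<tau>
    by (simp_all add: D_def v_def E_def correction_def Let_def)
  have v0: "v f \<tau> 0 = 0" if "problem u f \<tau>" for u f \<tau>
    using fv_solve_solution[OF problemD(3)[OF that]]
    by (cases k) (auto simp: v_def correction_def Let_def fv_solution_def)
  have v: "mean_order (Suc k) (\<lambda>u f \<tau>. dquot \<tau> (\<lambda>i. v f \<tau> i - u (pt \<tau> i)))"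
    and E: "\<And>l. 2 \<le> l \<Longrightarrow> l \<le> Suc k \<Longrightarrow> mean_order (Suc k + 1 - l)
      (\<lambda>u f \<tau> i. E f \<tau> l i - nderiv l u (pt \<tau> i))"
    using Suc by (auto simp: v_def E_def)
  have D1: "mean_order (Suc k + 1 - l) (\<lambda>u f \<tau> i. D f \<tau> l i - nderiv l u (pt \<tau> i))"
    if "1 \<le> l" "l \<le> Suc k" for l
    unfolding D_def by (rule approx_derivs_mean_order[OF Suc.prems v0 v E that])
  have D2: "mean_order (Suc k + 2 - l) (\<lambda>u f \<tau> i. D f \<tau> l i - nderiv l u (pt \<tau> i))"
    if "2 \<le> l" "l \<le> Suc k + 1" for l
    using approx_derivs_high_mean_order[OF Suc.prems v0 v E that] that
    by (simp add: D_def approx_derivs_def)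
  have "mean_order (Suc k + 1)
      (\<lambda>u f \<tau>. dquot \<tau> (\<lambda>i. correction \<alpha> \<beta> f \<tau> (Suc k) i - u (pt \<tau> i)))"
    by (rule error_mean_order[OF Suc.prems D1 D2])
      (simp_all add: level fv_solve_solution problem_def)
  then show ?case using D2 unfolding level by auto
qed

end

theorem theorem2p4:
  fixes \<alpha> \<beta> :: real and k :: nat
  assumes "0 \<le> \<alpha>" and "0 \<le> \<beta>" and "1 \<le> k"
  shows "\<exists>c>0. \<forall>u f. solves_bvp \<alpha> \<beta> f u \<and> C_unit (k + 2) u \<longrightarrow>
    (\<forall>\<tau>. admissible \<tau> \<longrightarrow>
      discrete_H10_norm \<tau> (\<lambda>i. correction \<alpha> \<beta> f \<tau> k i - u (pt \<tau> i))
        \<le> c * meshsize \<tau> ^ (k + 1) * C_norm (k + 2) u)"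
proof -
  interpret corrected_scheme \<alpha> \<beta> k
    using assms(1,2) by unfold_locales
  have "mean_order (k + 1) (\<lambda>u f \<tau>. dquot \<tau> (\<lambda>i. correction \<alpha> \<beta> f \<tau> k i - u (pt \<tau> i)))"
    using correction_mean_order[of k] by blast
  then obtain C where C: "0 \<le> C" "\<And>u f \<tau>. problem u f \<tau> \<Longrightarrow>
      wnorm \<tau> (dquot \<tau> (\<lambda>i. correction \<alpha> \<beta> f \<tau> k i - u (pt \<tau> i)))
        \<le> C * (meshsize \<tau> ^ (k + 1) * C_norm (k + 2) u)"
    by (rule mean_orderE) blast
  show ?thesis
  proof (intro exI[of _ "C + 1"] conjI allI impI)
    fix u f \<tau> assume "solves_bvp \<alpha> \<beta> f u \<and> C_unit (k + 2) u" "admissible \<tau>"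
    then have *: "problem u f \<tau>" by (simp add: problem_def)
    have "discrete_H10_norm \<tau> (\<lambda>i. correction \<alpha> \<beta> f \<tau> k i - u (pt \<tau> i))
        \<le> C * (meshsize \<tau> ^ (k + 1) * C_norm (k + 2) u)"
      using C(2)[OF *] discrete_H10_norm_eq_wnorm[OF problemD(3)[OF *]] by simp
    also have "\<dots> \<le> (C + 1) * (meshsize \<tau> ^ (k + 1) * C_norm (k + 2) u)"
      by (intro mult_right_mono problem_nonneg[OF *]) simp
    finally show "discrete_H10_norm \<tau> (\<lambda>i. correction \<alpha> \<beta> f \<tau> k i - u (pt \<tau> i))
        \<le> (C + 1) * meshsize \<tau> ^ (k + 1) * C_norm (k + 2) u"
      by (simp add: mult.assoc)
  qed (use C in simp)
qed

end
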